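(* For any $s>0$, there is a positive random variable $W_s$ such that for any $\lambda,x>0$, $$\lim_{t\to+\infty}\mathbb{P}_x\left[e^{-\lambda Z_t}\,\middle|\,t\le\zeta<t+s\right]=\mathrm{E}\left(e^{-\lambda W_s}\right)=\begin{cases}\dfrac{1-e^{-\alpha\phi(\lambda+\varphi(s))}}{1-e^{-\alpha s}},&\alpha>0;\\[2mm]\dfrac{\phi(\lambda+\varphi(s))}{s},&\alpha=0.\end{cases}$$ In particular, if $\alpha=0$, then $W_s$ has the distribution $\mathrm{P}(W_s\in\mathrm{d}r)=\mu_s(\mathrm{d}r)$, where $\mu_s(\mathrm{d}r)=e^{-\varphi(s)r}\frac{W(r)}{sr}\,\mathrm{d}r$, $r>0$. Otherwise, if $\alpha>0$, then $W_s$ has the size-biased Yaglom distribution $$\mathrm{P}(W_s\in\mathrm{d}r)=\frac{e^{-\varphi(s)r}\,\mathrm{P}(\Theta\in\mathrm{d}r)}{\mathrm{E}\left[e^{-\varphi(s)\Theta}\right]}.$$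
   Context: Branching mechanism: $\psi(\lambda)=\alpha\lambda+\frac12\sigma^2\lambda^2+\int_0^{+\infty}(e^{-\lambda r}-1+\lambda r)\,\pi(\mathrm{d}r)$, $\lambda\ge 0$, where $\alpha\ge 0$, $\sigma\ge 0$ and $\pi$ is a positive Radon measure on $(0,+\infty)$ with $\int_0^{+\infty}(r\wedge r^2)\,\pi(\mathrm{d}r)<+\infty$. It is assumed that $\psi(+\infty)=+\infty$ and $\int^{+\infty}\frac{1}{\psi(\lambda)}\,\mathrm{d}\lambda<+\infty$ (integrability at $+\infty$). CB process: $((Z_t)_{t\ge 0},(\mathbb{P}_x)_{x\ge 0})$ is the $[0,+\infty)$-valued right continuous strong Markov process with left limits, absorbed at $0$, with $\mathbb{P}_x(Z_0=x)=1$, and such that $\mathbb{P}_x[e^{-\lambda Z_t}]=e^{-x u_t(\lambda)}$ for $\lambda>0$, $t\ge 0$, where $\frac{\partial}{\partial t}u_t(\lambda)=-\psi(u_t(\lambda))$, $u_0(\lambda)=\lambda$. $\mathbb{P}_x[\cdot]$ also denotes expectation with respect to $\mathbb{P}_x$. The extinction time is $\zeta:=\inf\{t>0: Z_t=0\}$. $\phi(\lambda):=\int_\lambda^{+\infty}\frac{1}{\psi(u)}\,\mathrm{d}u$ for $\lambda>0$, which is a strictly decreasing bijection of $(0,+\infty)$, and $\varphi:(0,+\infty)\to(0,+\infty)$ is its inverse function. Scale function: $W$ (not to be confused with the random variables $W_s$) is the unique strictly increasing, nonnegative, continuous function on $[0,+\infty)$ with $\int_0^{+\infty}e^{-\lambda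 x}W(x)\,\mathrm{d}x=\frac1{\psi(\lambda)}$ for all $\lambda>0$. When $\alpha>0$, $\Theta$ is a positive random variable distributed according to the Yaglom distribution $\nu_\alpha$, the probability measure on $(0,+\infty)$ determined by $\mathrm{E}[e^{-\lambda\Theta}]=1-e^{-\alpha\phi(\lambda)}$ for all $\lambda>0$. *)

theory Defs
  imports "HOL-Probability.Probability"
begin

section \<open>Branching mechanisms\<close>

text \<open>The jump measure \<open>\<pi>\<close> is a measure on the space \<open>(0, \<infinity>)\<close> itself, so integrals with
  respect to \<open>\<pi>\<close> range over \<open>(0, \<infinity>)\<close>.\<close>

definition psi :: "real \<Rightarrow> real \<Rightarrow> real measure \<Rightarrow> real \<Rightarrow> real" where
  "psi \<alpha> \<sigma> \<pi> l =
     \<alpha> * l + 1/2 * \<sigma>\<^sup>2 * l\<^sup>2 + (LINT r|\<pi>. exp (- l * r) - 1 + l * r)"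

text \<open>\<open>compact_finite\<close> is the Radon property: on \<open>(0, \<infinity>)\<close> every locally finite Borel measure is
  Radon. The last two assumptions are \<open>\<psi>(\<infinity>) = \<infinity>\<close> and the integrability of \<open>1/\<psi>\<close> at infinity.\<close>

locale branching_mechanism =
  fixes \<alpha> \<sigma> :: real and \<pi> :: "real measure"
  assumes alpha_nonneg: "0 \<le> \<alpha>"
    and sigma_nonneg: "0 \<le> \<sigma>"
    and sets_pi: "sets \<pi> = sets (restrict_space borel {0<..})"
    and compact_finite: "\<And>K. compact K \<Longrightarrow> K \<subseteq> {0<..} \<Longrightarrow> emeasure \<pi> K < \<infinity>"
    and pi_moment: "(\<integral>\<^sup>+ r. ennreal (min r (r\<^sup>2)) \<partial>\<pi>) < \<infinity>"
    and psi_at_top: "filterlim (psi \<alpha> \<sigma> \<pi>) at_top at_top"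
    and grey: "\<exists>c>0. set_integrable lborel {c..} (\<lambda>l. 1 / psi \<alpha> \<sigma> \<pi> l)"

definition phi :: "(real \<Rightarrow> real) \<Rightarrow> real \<Rightarrow> real" where
  "phi \<psi> l = (LINT u:{l<..}|lborel. 1 / \<psi> u)"

definition varphi :: "(real \<Rightarrow> real) \<Rightarrow> real \<Rightarrow> real" where
  "varphi \<psi> = the_inv_into {0<..} (phi \<psi>)"

definition scale_function :: "(real \<Rightarrow> real) \<Rightarrow> (real \<Rightarrow> real) \<Rightarrow> bool" where
  "scale_function \<psi> W \<longleftrightarrow>
     strict_mono_on {0..} W \<and> (\<forall>x\<ge>0. 0 \<le> W x) \<and> continuous_on {0..} W \<and>
     (\<forall>l>0. set_integrable lborel {0..} (\<lambda>x. exp (- l * x) * W x) \<and>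
            (LINT x:{0..}|lborel. exp (- l * x) * W x) = 1 / \<psi> l)"

definition yaglom_distribution :: "real \<Rightarrow> (real \<Rightarrow> real) \<Rightarrow> real measure \<Rightarrow> bool" where
  "yaglom_distribution \<alpha> \<psi> \<nu> \<longleftrightarrow>
     prob_space \<nu> \<and> sets \<nu> = sets borel \<and> (AE r in \<nu>. 0 < r) \<and>
     (\<forall>l>0. (LINT r|\<nu>. exp (- l * r)) = 1 - exp (- \<alpha> * phi \<psi> l))"

definition mu :: "(real \<Rightarrow> real) \<Rightarrow> (real \<Rightarrow> real) \<Rightarrow> real \<Rightarrow> real measure" where
  "mu \<psi> W s =
     density lborel (\<lambda>r. indicator {0<..} r * ennreal (exp (- varphi \<psi> s * r) * (W r / (s * r))))"


section \<open>Continuous-state branching processes\<close>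

text \<open>Processes are indexed by real times, of which only the nonnegative ones matter. The index
  set of the filtration includes \<open>\<infinity>\<close>, so that stopping times may be infinite.\<close>

definition natural_filtration ::
    "'a measure \<Rightarrow> (real \<Rightarrow> 'a \<Rightarrow> real) \<Rightarrow> ennreal \<Rightarrow> 'a measure" where
  "natural_filtration M Z t =
     sigma (space M) {Z s -` B \<inter> space M | s B. 0 \<le> s \<and> ennreal s \<le> t \<and> B \<in> sets borel}"

definition cumulant :: "(real \<Rightarrow> real) \<Rightarrow> (real \<Rightarrow> real \<Rightarrow> real) \<Rightarrow> bool" where
  "cumulant \<psi> u \<longleftrightarrow>
     (\<forall>l>0. u 0 l = l \<and>
        (\<forall>t\<ge>0. 0 \<le> u t l \<and>
               ((\<lambda>s. u s l) has_real_derivative - \<psi> (u t l)) (at t within {0..})))"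

text \<open>Only the measurable structure of \<open>M\<close> is used; all the laws \<open>P x\<close>, \<open>x \<ge> 0\<close>, live on it.
  In \<open>strong_markov\<close> the time \<open>T\<close> may be infinite, and the identity is claimed on \<open>{T < \<infinity>}\<close> only.\<close>

locale cb_process =
  fixes \<psi> :: "real \<Rightarrow> real" and M :: "'a measure"
    and P :: "real \<Rightarrow> 'a measure" and Z :: "real \<Rightarrow> 'a \<Rightarrow> real"
  assumes prob_P: "\<And>x. 0 \<le> x \<Longrightarrow> prob_space (P x)"
    and sets_P: "\<And>x. 0 \<le> x \<Longrightarrow> sets (P x) = sets M"
    and measurable_Z: "\<And>t. 0 \<le> t \<Longrightarrow> Z t \<in> borel_measurable M"
    and Z_nonneg: "\<And>t \<omega>. 0 \<le> t \<Longrightarrow> \<omega> \<in> space M \<Longrightarrow> 0 \<le> Z t \<omega>"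
    and right_continuous: "\<And>t \<omega>. 0 \<le> t \<Longrightarrow> \<omega> \<in> space M \<Longrightarrow> continuous (at_right t) (\<lambda>s. Z s \<omega>)"
    and left_limits: "\<And>t \<omega>. 0 < t \<Longrightarrow> \<omega> \<in> space M \<Longrightarrow> \<exists>z. ((\<lambda>s. Z s \<omega>) \<longlongrightarrow> z) (at_left t)"
    and absorbed: "\<And>s t \<omega>. 0 \<le> s \<Longrightarrow> s \<le> t \<Longrightarrow> \<omega> \<in> space M \<Longrightarrow> Z s \<omega> = 0 \<Longrightarrow> Z t \<omega> = 0"
    and initial: "\<And>x. 0 \<le> x \<Longrightarrow> measure (P x) {\<omega> \<in> space M. Z 0 \<omega> = x} = 1"
    and kernel: "\<And>t B. 0 \<le> t \<Longrightarrow> B \<in> sets borel \<Longrightarrow>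
        (\<lambda>x. measure (P x) {\<omega> \<in> space M. Z t \<omega> \<in> B}) \<in> borel_measurable (restrict_space borel {0..})"
    and strong_markov: "\<And>x T u f.
        0 \<le> x \<Longrightarrow> stopping_time (natural_filtration M Z) T \<Longrightarrow> 0 \<le> u \<Longrightarrow>
        f \<in> borel_measurable borel \<Longrightarrow> bounded (range f) \<Longrightarrow>
        AE \<omega> in P x. T \<omega> < \<infinity> \<longrightarrow>
          real_cond_exp (P x) (filtration.pre_sigma (space M) (natural_filtration M Z) T)
            (\<lambda>\<omega>'. f (Z (enn2real (T \<omega>') + u) \<omega>')) \<omega>
          = (LINT \<omega>'|P (Z (enn2real (T \<omega>)) \<omega>). f (Z u \<omega>') :: real)"
    and laplace: "\<exists>u. cumulant \<psi> u \<and>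
        (\<forall>x\<ge>0. \<forall>l>0. \<forall>t\<ge>0. (LINT \<omega>|P x. exp (- l * Z t \<omega>)) = exp (- x * u t l))"

definition extinction_time :: "(real \<Rightarrow> 'a \<Rightarrow> real) \<Rightarrow> 'a \<Rightarrow> ennreal" where
  "extinction_time Z \<omega> = (INF t\<in>{t. 0 < t \<and> Z t \<omega> = 0}. ennreal t)"

definition expectation_given_event :: "'a measure \<Rightarrow> ('a \<Rightarrow> real) \<Rightarrow> 'a set \<Rightarrow> real" where
  "expectation_given_event M X A = (LINT \<omega>:A|M. X \<omega>) / measure M A"

end

theory Submission
  imports Defs
begin

text \<open>
  The function \<open>\<phi>\<close> straightens the flow of the cumulant: \<open>\<phi>' = - 1/\<psi>\<close> and \<open>u' = - \<psi>(u)\<close> give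
  \<open>\<phi>(u\<^sub>t(\<lambda>)) = \<phi>(\<lambda>) + t\<close>, that is \<open>u\<^sub>t(\<lambda>) = \<phi>\<inverse>(\<phi>(\<lambda>) + t)\<close> (\<open>cumulant_eq\<close>; the inverse \<open>\<phi>\<inverse>\<close> is the
  \<open>varphi\<close> of the statement). Letting \<open>\<lambda> \<rightarrow> \<infinity>\<close> in the Laplace transform of \<open>Z\<^sub>t\<close> gives the
  extinction probabilities \<open>P\<^sub>x(Z\<^sub>t = 0) = exp (- x \<phi>\<inverse>(t))\<close> (\<open>prob_absorbed\<close>). They are
  continuous in \<open>t\<close>, so up to null sets the conditioning event is \<open>{Z\<^sub>t \<noteq> 0, Z\<^bsub>t+s\<^esub> = 0}\<close>
  (\<open>extinct_before_AE\<close>). By the Markov property at time \<open>t\<close>, requiring \<open>Z\<^bsub>t+s\<^esub> = 0\<close> weights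
  \<open>e\<^bsup>- \<lambda> Z\<^esup>\<close> by another factor \<open>exp (- \<phi>\<inverse>(s) Z\<^sub>t)\<close>, that is, it shifts \<open>\<lambda>\<close> to \<open>\<lambda> + \<phi>\<inverse>(s)\<close>
  (\<open>markov_absorbed\<close>). With \<open>a = \<phi>(\<lambda> + \<phi>\<inverse>(s))\<close> and \<open>F(t) = P\<^sub>x(Z\<^sub>t = 0)\<close> the conditional
  expectation is therefore exactly \<open>(F(t + a) - F(t)) / (F(t + s) - F(t))\<close>.

  The limit of this quotient depends only on \<open>\<psi>\<close> near \<open>0\<close>, where \<open>\<psi>(l)/l \<rightarrow> \<alpha>\<close>, because
  \<open>\<phi>\<inverse>(t) \<rightarrow> 0\<close>. If \<open>\<alpha> > 0\<close>, then \<open>\<phi>\<inverse>\<close> decays exponentially at rate \<open>\<alpha>\<close>, and the increments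
  divided by \<open>\<phi>\<inverse>(t)\<close> converge to \<open>x (1 - e\<^bsup>- \<alpha> a\<^esup>)\<close> and \<open>x (1 - e\<^bsup>- \<alpha> s\<^esup>)\<close>
  (\<open>increment_subcritical\<close>). If \<open>\<alpha> = 0\<close>, then \<open>\<psi>(\<phi>\<inverse>)\<close>, the speed of \<open>\<phi>\<inverse>\<close>, is asymptotically constant on time
  intervals of bounded length, and the increments are proportional to \<open>a\<close> and \<open>s\<close>
  (\<open>increment_critical\<close>).

  Finally, both limits are Laplace transforms of explicit laws. Tilting the Yaglom law by
  \<open>exp (- \<phi>\<inverse>(s) r)\<close> shifts the argument of its Laplace transform, which settles \<open>\<alpha> > 0\<close>
  (\<open>size_biased_yaglom\<close>). For \<open>\<alpha> = 0\<close>, integrating \<open>\<integral> e\<^bsup>- u r\<^esup> W(r) dr = 1/\<psi>(u)\<close> over \<open>u > c\<close>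
  produces the weight \<open>1/r\<close> on the left and \<open>\<phi>(c)\<close> on the right (\<open>scale_function_laplace_div\<close>).
\<close>

section \<open>Branching mechanisms\<close>

text \<open>The integrand of the jump part of \<open>\<psi>\<close> is this single function evaluated at \<open>l * r\<close>. Its
  positivity and convexity pass to \<open>\<psi>\<close>, and its growth, at most quadratic at \<open>0\<close> and linear at
  infinity, matches the moment condition on \<open>\<pi>\<close>.\<close>

definition compensated_exp :: "real \<Rightarrow> real" where
  "compensated_exp x = exp (- x) - 1 + x"

lemma compensated_exp_nonneg: "0 \<le> compensated_exp x"
  using exp_ge_add_one_self[of "- x"] by (simp add: compensated_exp_def)

lemma compensated_exp_pos: "0 < x \<Longrightarrow> 0 < compensated_exp x"
  using exp_minus_greater[of x] by (simp add: compensated_exp_def)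

lemma compensated_exp_le_self: "0 \<le> x \<Longrightarrow> compensated_exp x \<le> x"
  by (simp add: compensated_exp_def)

lemma compensated_exp_le_square:
  assumes "0 \<le> x"
  shows "compensated_exp x \<le> x\<^sup>2"
proof (cases "x \<le> 1")
  case True
  have "exp (- x) * (1 + x) \<le> exp (- x) * exp x"
    by (intro mult_left_mono) (auto simp: exp_ge_add_one_self)
  also have "\<dots> = 1"
    by (simp flip: exp_add)
  also have "1 \<le> (1 - x + x\<^sup>2) * (1 + x)"
    using assms by (simp add: algebra_simps power2_eq_square)
  finally have "exp (- x) \<le> 1 - x + x\<^sup>2"
    using assms by (simp add: mult_le_cancel_right)
  then show ?thesis by (simp add: compensated_exp_def)
next
  case False
  then have "x * 1 \<le> x * x" by (intro mult_left_mono) auto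
  then show ?thesis using compensated_exp_le_self[OF assms] by (simp add: power2_eq_square)
qed

text \<open>Separating the variables in this way turns the moment condition on \<open>\<pi>\<close> into integrability
  for every \<open>l\<close>, and for \<open>l \<le> 1\<close> into a majorant that survives division by \<open>l\<close>.\<close>

lemma compensated_exp_le_min:
  assumes "0 \<le> l" "0 \<le> r"
  shows "compensated_exp (l * r) \<le> max l (l\<^sup>2) * min r (r\<^sup>2)"
proof -
  have "l * r \<le> max l (l\<^sup>2) * r" "(l * r)\<^sup>2 \<le> max l (l\<^sup>2) * r\<^sup>2"
    using assms by (auto simp: power_mult_distrib intro!: mult_right_mono)
  with compensated_exp_le_self[of "l * r"] compensated_exp_le_square[of "l * r"] assms show ?thesis
    by (auto simp: min_def)
qed

lemma convex_on_compensated_exp: "convex_on UNIV compensated_exp"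
  unfolding compensated_exp_def
  by (rule convex_on_realI[where f' = "\<lambda>x. 1 - exp (- x)"])
     (auto intro!: derivative_eq_intros)

lemma compensated_exp_measurable [measurable]: "compensated_exp \<in> borel_measurable borel"
  unfolding compensated_exp_def by measurable

context branching_mechanism
begin

lemma space_pi: "space \<pi> = {0<..}"
  using sets_eq_imp_space_eq[OF sets_pi] by (simp add: space_restrict_space)

lemma measurable_pi: "f \<in> borel_measurable borel \<Longrightarrow> f \<in> borel_measurable \<pi>"
  for f :: "real \<Rightarrow> real"
  using measurable_cong_sets[OF sets_pi refl] by (auto intro: measurable_restrict_space1)

lemma integrable_min_square: "integrable \<pi> (\<lambda>r. min r (r\<^sup>2))"
proof (rule integrableI_nonneg)
  show "AE r in \<pi>. 0 \<le> min r (r\<^sup>2)"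
    by (rule AE_I2) (simp add: space_pi)
qed (use pi_moment in \<open>auto intro!: measurable_pi\<close>)

lemma integrable_compensated_exp:
  assumes "0 \<le> l"
  shows "integrable \<pi> (\<lambda>r. compensated_exp (l * r))"
proof (rule Bochner_Integration.integrable_bound)
  show "integrable \<pi> (\<lambda>r. max l (l\<^sup>2) * min r (r\<^sup>2))"
    using integrable_min_square by simp
  show "AE r in \<pi>. norm (compensated_exp (l * r)) \<le> norm (max l (l\<^sup>2) * min r (r\<^sup>2))"
    using assms compensated_exp_le_min[of l] compensated_exp_nonneg
    by (intro AE_I2) (auto simp: space_pi intro: order_trans)
qed (auto intro!: measurable_pi)

lemma psi_eq: "psi \<alpha> \<sigma> \<pi> l = \<alpha> * l + 1/2 * \<sigma>\<^sup>2 * l\<^sup>2 + (LINT r|\<pi>. compensated_exp (l * r))"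
  by (simp add: psi_def compensated_exp_def)

text \<open>All three parts of \<open>\<psi>\<close> are nonnegative, so a zero at some \<open>l > 0\<close> kills each of them; the jump
  part vanishes only if \<open>\<pi> = 0\<close>. Then \<open>\<psi>\<close> would vanish identically, against \<open>\<psi>(\<infinity>) = \<infinity>\<close>.\<close>

lemma psi_pos:
  assumes "0 < l"
  shows "0 < psi \<alpha> \<sigma> \<pi> l"
proof (rule ccontr)
  assume neg: "\<not> 0 < psi \<alpha> \<sigma> \<pi> l"
  have I: "0 \<le> (LINT r|\<pi>. compensated_exp (l * r))"
    by (simp add: compensated_exp_nonneg)
  have "0 \<le> \<alpha> * l" "0 \<le> 1/2 * \<sigma>\<^sup>2 * l\<^sup>2"
    using assms alpha_nonneg by auto
  then have z: "\<alpha> * l = 0" "1/2 * \<sigma>\<^sup>2 * l\<^sup>2 = 0" "(LINT r|\<pi>. compensated_exp (l * r)) = 0"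
    using neg I unfolding psi_eq by linarith+
  then have "AE r in \<pi>. compensated_exp (l * r) = 0"
    using integral_nonneg_eq_0_iff_AE[OF integrable_compensated_exp[of l]] assms compensated_exp_nonneg by simp
  moreover have "compensated_exp (l * r) \<noteq> 0" if "r \<in> space \<pi>" for r
    using that assms compensated_exp_pos[of "l * r"] by (simp add: space_pi)
  ultimately have "AE r in \<pi>. False"
    by (auto elim: AE_mp intro!: AE_I2)
  then have "(LINT r|\<pi>. compensated_exp (k * r)) = (LINT r|\<pi>. 0)" for k
    by (intro integral_cong_AE) (auto intro!: measurable_pi elim: AE_mp)
  then have "psi \<alpha> \<sigma> \<pi> k = 0" for k
    using z assms unfolding psi_eq by simp
  then show False
    using psi_at_top unfolding filterlim_at_top_dense by (auto simp: eventually_at_top_linorder)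
qed

lemma convex_on_psi: "convex_on {0..} (psi \<alpha> \<sigma> \<pi>)"
proof (rule convex_onI)
  fix t x y :: real
  assume t: "0 < t" "t < 1" and xy: "x \<in> {0..}" "y \<in> {0..}"
  let ?z = "(1 - t) * x + t * y"
  have z: "0 \<le> ?z" using t xy by simp
  have "(LINT r|\<pi>. compensated_exp (?z * r)) \<le> (LINT r|\<pi>. (1 - t) * compensated_exp (x * r) + t * compensated_exp (y * r))"
  proof (intro integral_mono)
    show "compensated_exp (?z * r) \<le> (1 - t) * compensated_exp (x * r) + t * compensated_exp (y * r)" for r
      using convex_onD[OF convex_on_compensated_exp, of t "x * r" "y * r"] t by (simp add: algebra_simps)
  qed (use z xy in \<open>auto intro!: integrable_compensated_exp\<close>)
  also have "\<dots> = (1 - t) * (LINT r|\<pi>. compensated_exp (x * r)) + t * (LINT r|\<pi>. compensated_exp (y * r))"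
    using xy by (simp add: integrable_compensated_exp)
  finally have 1: "(LINT r|\<pi>. compensated_exp (?z * r)) \<le> \<dots>" .
  have "(1 - t) * x\<^sup>2 + t * y\<^sup>2 - ?z\<^sup>2 = t * (1 - t) * (x - y)\<^sup>2"
    by (simp add: power2_eq_square algebra_simps)
  moreover have "0 \<le> t * (1 - t) * (x - y)\<^sup>2"
    using t by simp
  ultimately have "?z\<^sup>2 \<le> (1 - t) * x\<^sup>2 + t * y\<^sup>2" by linarith
  then have 2: "1/2 * \<sigma>\<^sup>2 * ?z\<^sup>2 \<le> 1/2 * \<sigma>\<^sup>2 * ((1 - t) * x\<^sup>2 + t * y\<^sup>2)"
    by (intro mult_left_mono) auto
  have "\<alpha> * ?z + 1/2 * \<sigma>\<^sup>2 * ?z\<^sup>2 + (LINT r|\<pi>. compensated_exp (?z * r))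
      \<le> \<alpha> * ?z + 1/2 * \<sigma>\<^sup>2 * ((1 - t) * x\<^sup>2 + t * y\<^sup>2)
        + ((1 - t) * (LINT r|\<pi>. compensated_exp (x * r)) + t * (LINT r|\<pi>. compensated_exp (y * r)))"
    by (intro add_mono 1 2 order_refl)
  also have "\<dots> = (1 - t) * psi \<alpha> \<sigma> \<pi> x + t * psi \<alpha> \<sigma> \<pi> y"
    unfolding psi_eq by algebra
  finally have "psi \<alpha> \<sigma> \<pi> ?z \<le> (1 - t) * psi \<alpha> \<sigma> \<pi> x + t * psi \<alpha> \<sigma> \<pi> y"
    by (simp add: psi_eq)
  then show "psi \<alpha> \<sigma> \<pi> ((1 - t) *\<^sub>R x + t *\<^sub>R y) \<le> (1 - t) * psi \<alpha> \<sigma> \<pi> x + t * psi \<alpha> \<sigma> \<pi> y"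
    by simp
qed simp

text \<open>The Gaussian part is of order \<open>l\<^sup>2\<close>. In the jump part the quotient tends to \<open>0\<close> pointwise,
  and \<open>min r (r\<^sup>2)\<close> dominates it as long as \<open>l < 1\<close>.\<close>

lemma psi_slope_at_zero: "((\<lambda>l. psi \<alpha> \<sigma> \<pi> l / l) \<longlongrightarrow> \<alpha>) (at_right 0)"
proof (rule tendsto_at_right_sequentially[of 0 1])
  fix S :: "nat \<Rightarrow> real"
  assume S: "\<And>n. 0 < S n" "\<And>n. S n < 1" and lim: "S \<longlonglongrightarrow> 0"
  have "(\<lambda>n. LINT r|\<pi>. compensated_exp (S n * r) / S n) \<longlonglongrightarrow> (LINT r|\<pi>. 0)"
  proof (rule integral_dominated_convergence[OF _ _ integrable_min_square])
    have bound: "compensated_exp (S n * r) / S n \<le> min r (r\<^sup>2)" if "0 < r" for r n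
    proof -
      have "(S n)\<^sup>2 \<le> S n"
        using S(1)[of n] S(2)[of n] by (simp add: power2_eq_square)
      then have "max (S n) ((S n)\<^sup>2) = S n"
        by (simp add: max_def)
      with compensated_exp_le_min[of "S n" r] S(1)[of n] that
      have "compensated_exp (S n * r) \<le> S n * min r (r\<^sup>2)"
        by simp
      then show ?thesis
        by (metis S(1) pos_divide_le_eq mult.commute)
    qed
    show "AE r in \<pi>. norm (compensated_exp (S n * r) / S n) \<le> min r (r\<^sup>2)" for n
      using bound S(1) by (intro AE_I2) (auto simp: space_pi compensated_exp_nonneg less_imp_le)
    show "AE r in \<pi>. (\<lambda>n. compensated_exp (S n * r) / S n) \<longlonglongrightarrow> 0"
    proof (rule AE_I2)
      fix r assume "r \<in> space \<pi>"
      show "(\<lambda>n. compensated_exp (S n * r) / S n) \<longlonglongrightarrow> 0"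
      proof (rule tendsto_sandwich[of "\<lambda>_. 0"])
        show "\<forall>\<^sub>F n in sequentially. compensated_exp (S n * r) / S n \<le> S n * r\<^sup>2"
        proof (rule always_eventually, rule allI)
          fix n
          show "compensated_exp (S n * r) / S n \<le> S n * r\<^sup>2"
            using compensated_exp_le_square[of "S n * r"] S(1)[of n] \<open>r \<in> space \<pi>\<close>
            by (simp add: space_pi field_simps power2_eq_square)
        qed
        show "(\<lambda>n. S n * r\<^sup>2) \<longlonglongrightarrow> 0"
          using tendsto_mult_right[OF lim, of "r\<^sup>2"] by simp
        show "\<forall>\<^sub>F n in sequentially. 0 \<le> compensated_exp (S n * r) / S n"
          using S(1) by (simp add: compensated_exp_nonneg less_imp_le)
      qed auto
    qed
  qed (auto intro!: measurable_pi)
  then have "(\<lambda>n. \<alpha> + 1/2 * \<sigma>\<^sup>2 * S n + (LINT r|\<pi>. compensated_exp (S n * r)) / S n)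
      \<longlonglongrightarrow> \<alpha> + 1/2 * \<sigma>\<^sup>2 * 0 + 0"
    by (intro tendsto_intros lim) simp
  moreover have "psi \<alpha> \<sigma> \<pi> (S n) / S n
      = \<alpha> + 1/2 * \<sigma>\<^sup>2 * S n + (LINT r|\<pi>. compensated_exp (S n * r)) / S n" for n
    using S(1)[of n] by (simp add: psi_eq field_simps power2_eq_square)
  ultimately show "(\<lambda>n. psi \<alpha> \<sigma> \<pi> (S n) / S n) \<longlonglongrightarrow> \<alpha>"
    by simp
qed simp

end

section \<open>The function \<open>\<phi>\<close> and its inverse\<close>

text \<open>The asymptotics of the process depend on \<open>\<psi>\<close> only through these properties. Near \<open>0\<close> the single
  number \<open>\<alpha>\<close> decides between the two regimes of the theorem.\<close>

locale critical_or_subcritical =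
  fixes \<psi> :: "real \<Rightarrow> real" and \<alpha> :: real
  assumes convex: "convex_on {0..} \<psi>"
    and zero: "\<psi> 0 = 0"
    and pos: "\<And>l. 0 < l \<Longrightarrow> 0 < \<psi> l"
    and slope: "((\<lambda>l. \<psi> l / l) \<longlongrightarrow> \<alpha>) (at_right 0)"
    and integrable_tail: "\<exists>c>0. set_integrable lborel {c..} (\<lambda>l. 1 / \<psi> l)"
begin

lemma continuous_psi: "continuous_on {0<..} \<psi>"
  by (rule convex_on_continuous) (auto intro: convex_on_subset[OF convex])

lemma chord:
  assumes "0 < x" "x \<le> y"
  shows "\<psi> x \<le> x * (\<psi> y / y)"
proof -
  have "\<psi> ((1 - x / y) *\<^sub>R 0 + (x / y) *\<^sub>R y) \<le> (1 - x / y) * \<psi> 0 + (x / y) * \<psi> y"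
    using assms by (intro convex_onD[OF convex]) auto
  then show ?thesis using assms by (simp add: zero)
qed

lemma psi_mono:
  assumes "0 < x" "x \<le> y"
  shows "\<psi> x \<le> \<psi> y"
proof -
  have "\<psi> x \<le> (x / y) * \<psi> y"
    using chord[OF assms] by simp
  also have "\<dots> \<le> 1 * \<psi> y"
    using assms pos[of y] by (intro mult_right_mono) auto
  finally show ?thesis by simp
qed

text \<open>By convexity the slope of \<open>\<psi>\<close> over \<open>[x, y]\<close> is at most the one over \<open>[y, 2 y]\<close>. This replaces a
  derivative of \<open>\<psi>\<close>: the bound \<open>\<psi> (2 * y) / y\<close> tends to \<open>0\<close> with \<open>y\<close> in the critical case.\<close>

lemma slope_bound:
  assumes "0 < x" "x \<le> y"
  shows "\<psi> y - \<psi> x \<le> (y - x) * (\<psi> (2 * y) / y)"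
proof (cases "x = y")
  case False
  then have less: "x < y" using assms by simp
  have "(\<psi> y - \<psi> x) / (y - x) \<le> (\<psi> (2 * y) - \<psi> y) / y"
    using convex_on_slope_le(1)[OF convex, of x "2 * y" y] convex_on_slope_le(2)[OF convex, of x "2 * y" y] assms less
    by (simp add: divide_simps) (simp add: algebra_simps)
  also have "\<dots> \<le> \<psi> (2 * y) / y"
    using assms pos[of y] by (intro divide_right_mono) auto
  finally show ?thesis
    using less by (simp add: pos_divide_le_eq mult.commute)
qed simp

lemma continuous_inverse_psi: "continuous_on {0<..} (\<lambda>u. 1 / \<psi> u)"
  by (intro continuous_intros continuous_psi) (auto dest: pos)

lemma tail_integrable:
  assumes "0 < l"
  shows "set_integrable lborel {l..} (\<lambda>u. 1 / \<psi> u)"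
proof -
  obtain c where c: "0 < c" "set_integrable lborel {c..} (\<lambda>u. 1 / \<psi> u)"
    using integrable_tail by blast
  have "set_integrable lborel {l..c} (\<lambda>u. 1 / \<psi> u)"
    using assms by (intro borel_integrable_atLeastAtMost' continuous_on_subset[OF continuous_inverse_psi]) auto
  then have "set_integrable lborel ({l..c} \<union> {c..}) (\<lambda>u. 1 / \<psi> u)"
    using c by (intro set_integrable_Un) auto
  then show ?thesis
    by (rule set_integrable_subset) auto
qed

lemma tail_integrable_open: "0 < l \<Longrightarrow> set_integrable lborel {l<..} (\<lambda>u. 1 / \<psi> u)"
  by (rule set_integrable_subset[OF tail_integrable[of l]]) auto

lemma phi_split:
  assumes "0 < c" "c \<le> x"
  shows "phi \<psi> c = integral {c..x} (\<lambda>u. 1 / \<psi> u) + phi \<psi> x"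
proof -
  have split: "{c<..} = {c<..x} \<union> {x<..}" using assms by auto
  have i1: "set_integrable lborel {c<..x} (\<lambda>u. 1 / \<psi> u)"
    by (rule set_integrable_subset[OF tail_integrable[OF assms(1)]]) auto
  have i2: "set_integrable lborel {c..x} (\<lambda>u. 1 / \<psi> u)"
    by (rule set_integrable_subset[OF tail_integrable[OF assms(1)]]) auto
  have "phi \<psi> c = (LINT u:{c<..x}|lborel. 1 / \<psi> u) + phi \<psi> x"
    unfolding phi_def split
    by (rule set_integral_Un[OF _ i1 tail_integrable_open]) (use assms in auto)
  also have "(LINT u:{c<..x}|lborel. 1 / \<psi> u) = (LINT u:{c..x}|lborel. 1 / \<psi> u)"
    unfolding set_lebesgue_integral_def
  proof (rule integral_cong_AE)
    show "AE u in lborel. indicator {c<..x} u *\<^sub>R (1 / \<psi> u) = indicator {c..x} u *\<^sub>R (1 / \<psi> u)"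
      using AE_lborel_singleton[of c] by eventually_elim (auto simp: indicator_def)
  qed (use i1 i2 in \<open>auto simp: set_integrable_def\<close>)
  also have "\<dots> = integral {c..x} (\<lambda>u. 1 / \<psi> u)"
    by (rule set_borel_integral_eq_integral(2)[OF i2])
  finally show ?thesis .
qed

lemma DERIV_phi:
  assumes "0 < x"
  shows "(phi \<psi> has_real_derivative - (1 / \<psi> x)) (at x)"
proof -
  let ?c = "x / 2" and ?d = "2 * x"
  have cont: "continuous_on {?c..?d} (\<lambda>u. 1 / \<psi> u)"
    using assms by (intro continuous_on_subset[OF continuous_inverse_psi]) auto
  have "((\<lambda>v. integral {?c..v} (\<lambda>u. 1 / \<psi> u)) has_real_derivative 1 / \<psi> x) (at x within {?c..?d})"
    by (rule integral_has_real_derivative[OF cont]) (use assms in auto)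
  then have "((\<lambda>v. integral {?c..v} (\<lambda>u. 1 / \<psi> u)) has_real_derivative 1 / \<psi> x) (at x)"
    using at_within_interior[of x "{?c..?d}"] assms by simp
  then have "((\<lambda>v. phi \<psi> ?c - integral {?c..v} (\<lambda>u. 1 / \<psi> u)) has_real_derivative 0 - 1 / \<psi> x) (at x)"
    by (intro DERIV_diff DERIV_const)
  moreover have "\<forall>\<^sub>F v in nhds x. phi \<psi> v = phi \<psi> ?c - integral {?c..v} (\<lambda>u. 1 / \<psi> u)"
  proof (rule eventually_nhds_in_open[of "{?c<..}", THEN eventually_mono])
    show "phi \<psi> v = phi \<psi> ?c - integral {?c..v} (\<lambda>u. 1 / \<psi> u)" if "v \<in> {?c<..}" for v
      using phi_split[of ?c v] that assms by simp
  qed (use assms in auto)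
  ultimately show ?thesis
    by (subst DERIV_cong_ev[OF refl _ refl]) auto
qed

lemma isCont_phi: "0 < x \<Longrightarrow> isCont (phi \<psi>) x"
  using DERIV_phi DERIV_isCont by blast

lemma phi_strict_antimono: "0 < x \<Longrightarrow> x < y \<Longrightarrow> phi \<psi> y < phi \<psi> x"
  by (rule DERIV_neg_imp_decreasing) (auto intro!: exI DERIV_phi dest: pos simp: pos)

lemma phi_at_top: "(phi \<psi> \<longlongrightarrow> 0) at_top"
proof -
  let ?g = "\<lambda>l u. indicator {max 1 l<..} u *\<^sub>R (1 / \<psi> u)"
  let ?w = "\<lambda>u. indicator {1..} u *\<^sub>R (1 / \<psi> u)"
  have "((\<lambda>l. integral\<^sup>L lborel (?g l)) \<longlongrightarrow> integral\<^sup>L lborel (\<lambda>_::real. 0)) at_top"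
  proof (rule integral_dominated_convergence_at_top[where w = ?w])
    show "integrable lborel ?w"
      using tail_integrable[of 1] by (simp add: set_integrable_def)
    show "?g l \<in> borel_measurable lborel" for l
      using tail_integrable_open[of "max 1 l"] by (simp add: set_integrable_def)
    show "\<forall>\<^sub>F l in at_top. AE u in lborel. norm (?g l u) \<le> ?w u"
      by (intro always_eventually allI AE_I2) (auto simp: indicator_def abs_of_pos pos intro!: less_imp_le[OF pos])
    show "AE u in lborel. ((\<lambda>l. ?g l u) \<longlongrightarrow> 0) at_top"
    proof (rule AE_I2)
      fix u
      have "\<forall>\<^sub>F l in at_top. ?g l u = 0"
        using eventually_ge_at_top[of u] by eventually_elim auto
      then show "((\<lambda>l. ?g l u) \<longlongrightarrow> 0) at_top"
        by (rule tendsto_eventually)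
    qed
  qed simp
  moreover have "\<forall>\<^sub>F l in at_top. integral\<^sup>L lborel (?g l) = phi \<psi> l"
    using eventually_ge_at_top[of 1]
    by eventually_elim (simp add: phi_def set_lebesgue_integral_def max_absorb2)
  ultimately show ?thesis
    by (auto elim: Lim_transform_eventually)
qed

lemma phi_pos:
  assumes "0 < x"
  shows "0 < phi \<psi> x"
proof (rule DERIV_neg_imp_decreasing_at_top[OF _ phi_at_top])
  show "\<exists>y. DERIV (phi \<psi>) z :> y \<and> y < 0" if "x \<le> z" for z
    using assms that DERIV_phi[of z] pos[of z] by (intro exI[of _ "- (1 / \<psi> z)"]) auto
qed

text \<open>Since \<open>\<psi>\<close> lies below its chord on \<open>[0, 1]\<close>, \<open>1/\<psi>\<close> dominates a multiple of \<open>1/u\<close>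
  there. So \<open>\<phi>\<close> explodes at \<open>0\<close>, logarithmically at least, which is the missing half of the
  surjectivity of \<open>\<phi>\<close>.\<close>

lemma phi_lower_bound:
  assumes "0 < x" "x \<le> 1"
  shows "phi \<psi> 1 - ln x / \<psi> 1 \<le> phi \<psi> x"
proof -
  have "phi \<psi> x + ln x / \<psi> 1 \<ge> phi \<psi> 1 + ln 1 / \<psi> 1"
  proof (rule DERIV_nonpos_imp_nonincreasing[OF assms(2)])
    fix z assume z: "x \<le> z" "z \<le> 1"
    have "DERIV (\<lambda>z. phi \<psi> z + ln z / \<psi> 1) z :> - (1 / \<psi> z) + (1 / z) / \<psi> 1"
      using z assms pos[of 1] by (auto intro!: derivative_eq_intros DERIV_phi)
    moreover have "(1 / z) / \<psi> 1 \<le> 1 / \<psi> z"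
      using chord[of z 1] pos[of z] pos[of 1] z assms by (simp add: divide_simps mult.commute)
    ultimately show "\<exists>y. DERIV (\<lambda>z. phi \<psi> z + ln z / \<psi> 1) z :> y \<and> y \<le> 0"
      by force
  qed
  then show ?thesis by simp
qed

lemma bij_betw_phi: "bij_betw (phi \<psi>) {0<..} {0<..}"
proof (rule bij_betw_imageI)
  show "inj_on (phi \<psi>) {0<..}"
    by (rule linorder_inj_onI') (auto dest: phi_strict_antimono)
  show "phi \<psi> ` {0<..} = {0<..}"
  proof (intro equalityI subsetI)
    fix t :: real assume "t \<in> {0<..}"
    then have t: "0 < t" by simp
    have "\<forall>\<^sub>F x in at_top. phi \<psi> x < t"
      using order_tendstoD(2)[OF phi_at_top t] .
    then obtain b where b: "1 \<le> b" "phi \<psi> b < t"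
      using eventually_happens[OF eventually_conj[OF _ eventually_ge_at_top[of "1::real"]]] by auto
    \<comment> \<open>chosen so that \<open>- ln a / \<psi> 1 = t\<close> in \<open>phi_lower_bound\<close>\<close>
    define a where "a = exp (- t * \<psi> 1)"
    have a: "0 < a" "a \<le> 1" using t pos[of 1] by (auto simp: a_def)
    have "t \<le> phi \<psi> a"
      using phi_lower_bound[OF a] phi_pos[of 1] pos[of 1] by (simp add: a_def)
    with b a have "\<exists>x\<ge>a. x \<le> b \<and> phi \<psi> x = t"
      by (intro IVT2) (auto intro!: isCont_phi)
    then show "t \<in> phi \<psi> ` {0<..}"
      using a by auto
  qed (auto intro: phi_pos)
qed

lemma varphi_pos: "0 < t \<Longrightarrow> 0 < varphi \<psi> t"
  and phi_varphi: "0 < t \<Longrightarrow> phi \<psi> (varphi \<psi> t) = t"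
  and varphi_phi: "0 < l \<Longrightarrow> varphi \<psi> (phi \<psi> l) = l"
  using bij_betw_phi the_inv_into_into[of "phi \<psi>" "{0<..}" t "{0<..}"]
    f_the_inv_into_f[of "phi \<psi>" "{0<..}" t] the_inv_into_f_f[of "phi \<psi>" "{0<..}" l]
  by (auto simp: bij_betw_def varphi_def)

lemma isCont_varphi:
  assumes "0 < t"
  shows "isCont (varphi \<psi>) t"
proof -
  let ?x = "varphi \<psi> t"
  have "isCont (varphi \<psi>) (phi \<psi> ?x)"
    by (rule isCont_inverse_function2[of "?x / 2" ?x "2 * ?x"])
       (use varphi_pos[OF assms] in \<open>auto intro!: varphi_phi isCont_phi\<close>)
  then show ?thesis using assms by (simp add: phi_varphi)
qed

lemma DERIV_varphi:
  assumes "0 < t"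
  shows "(varphi \<psi> has_real_derivative - \<psi> (varphi \<psi> t)) (at t)"
proof -
  have "(varphi \<psi> has_real_derivative inverse (- (1 / \<psi> (varphi \<psi> t)))) (at t)"
    using assms varphi_pos[OF assms] pos[of "varphi \<psi> t"]
    by (intro DERIV_inverse_function[where a = 0 and b = "t + 1" and f = "phi \<psi>"])
       (auto intro!: DERIV_phi phi_varphi isCont_varphi)
  then show ?thesis by simp
qed

lemma varphi_strict_antimono: "0 < s \<Longrightarrow> s < t \<Longrightarrow> varphi \<psi> t < varphi \<psi> s"
  by (rule DERIV_neg_imp_decreasing) (auto intro!: exI DERIV_varphi dest: varphi_pos simp: pos varphi_pos)

lemma varphi_at_top: "filterlim (varphi \<psi>) (at_right 0) at_top"
  unfolding filterlim_at
proof
  show "\<forall>\<^sub>F t in at_top. varphi \<psi> t \<in> {0<..} \<and> varphi \<psi> t \<noteq> 0"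
    using eventually_gt_at_top[of 0] by eventually_elim (use varphi_pos in force)
  show "(varphi \<psi> \<longlongrightarrow> 0) at_top"
  proof (rule order_tendstoI)
    fix e :: real assume e: "0 < e"
    show "\<forall>\<^sub>F t in at_top. varphi \<psi> t < e"
      using eventually_gt_at_top[of "phi \<psi> e"]
    proof eventually_elim
      case (elim t)
      then show ?case
        using varphi_strict_antimono[of "phi \<psi> e" t] phi_pos[OF e] varphi_phi[OF e] by simp
    qed
  next
    fix e :: real assume "e < 0"
    show "\<forall>\<^sub>F t in at_top. e < varphi \<psi> t"
      using eventually_gt_at_top[of 0]
      by eventually_elim (use \<open>e < 0\<close> varphi_pos in force)
  qed
qed

end

lemma (in branching_mechanism) critical_or_subcritical_psi:
  "critical_or_subcritical (psi \<alpha> \<sigma> \<pi>) \<alpha>"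
proof
  show "psi \<alpha> \<sigma> \<pi> 0 = 0" by (simp add: psi_def)
qed (auto intro: convex_on_psi psi_pos psi_slope_at_zero grey)

section \<open>The cumulant semigroup\<close>

context critical_or_subcritical
begin

text \<open>The flow cannot reach \<open>0\<close> in finite time: as \<open>u\<close> decreases from \<open>l\<close>, the chord bound
  \<open>\<psi>(u) \<le> C u\<close> with \<open>C = \<psi>(l)/l\<close> holds along it, so \<open>e\<^bsup>C t\<^esup> u\<^sub>t\<close> is nondecreasing. Positivity keeps
  the flow in the domain of \<open>\<phi>\<close>.\<close>

lemma cumulant_pos:
  assumes u: "cumulant \<psi> u" and l: "0 < l" and t: "0 \<le> t"
  shows "0 < u t l"
proof -
  let ?C = "\<psi> l / l"
  have u0: "u 0 l = l" and nonneg: "\<And>r. 0 \<le> r \<Longrightarrow> 0 \<le> u r l"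
    and der: "\<And>r. 0 \<le> r \<Longrightarrow> ((\<lambda>r. u r l) has_real_derivative - \<psi> (u r l)) (at r within {0..})"
    using u l unfolding cumulant_def by auto
  have der': "((\<lambda>r. u r l) has_real_derivative - \<psi> (u r l)) (at r)" if "0 < r" for r
    using der[of r] that at_within_interior[of r "{0..}"] by simp
  have cont: "continuous_on {0..r} (\<lambda>r. u r l)" for r
    by (rule continuous_on_subset[of "{0..}"], rule DERIV_continuous_on, rule der) auto
  have psi_nonneg: "0 \<le> \<psi> (u r l)" if "0 \<le> r" for r
    using nonneg[OF that] pos[of "u r l"] zero by (cases "u r l = 0") auto
  have le: "u r l \<le> l" if "0 \<le> r" for r
  proof -
    have "u r l \<le> u 0 l"
    proof (rule DERIV_nonpos_imp_decreasing_open[OF that])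
      show "\<exists>y. DERIV (\<lambda>r. u r l) q :> y \<and> y \<le> 0" if "0 < q" for q
        using der'[OF that] psi_nonneg[of q] that by (intro exI[of _ "- \<psi> (u q l)"]) simp
    qed (rule cont)
    then show ?thesis by (simp add: u0)
  qed
  have "exp (?C * 0) * u 0 l \<le> exp (?C * t) * u t l"
  proof (rule DERIV_nonneg_imp_increasing_open[OF t])
    fix r assume r: "0 < r" "r < t"
    have "DERIV (\<lambda>r. exp (?C * r) * u r l) r :> exp (?C * r) * (u r l * ?C - \<psi> (u r l))"
      using r l by (auto intro!: derivative_eq_intros der' simp: algebra_simps)
    moreover have "\<psi> (u r l) \<le> u r l * ?C"
      using chord[of "u r l" l] le[of r] nonneg[of r] r zero by (cases "u r l = 0") auto
    ultimately show "\<exists>y. DERIV (\<lambda>r. exp (?C * r) * u r l) r :> y \<and> 0 \<le> y"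
      by (intro exI conjI) (assumption, simp)
  qed (intro continuous_intros cont)
  then have "0 < exp (?C * t) * u t l" using u0 l by simp
  then show ?thesis by (simp add: zero_less_mult_iff)
qed

lemma cumulant_eq:
  assumes u: "cumulant \<psi> u" and l: "0 < l" and t: "0 \<le> t"
  shows "u t l = varphi \<psi> (phi \<psi> l + t)"
proof -
  have u0: "u 0 l = l"
    and der: "\<And>r. 0 \<le> r \<Longrightarrow> ((\<lambda>r. u r l) has_real_derivative - \<psi> (u r l)) (at r within {0..})"
    using u l unfolding cumulant_def by auto
  have "((\<lambda>r. phi \<psi> (u r l) - r) has_real_derivative 0) (at r within {0..})" if "r \<in> {0..}" for r
  proof -
    have p: "0 < u r l" using cumulant_pos[OF u l] that by simp
    have "((\<lambda>r. phi \<psi> (u r l)) has_real_derivative - (1 / \<psi> (u r l)) * - \<psi> (u r l)) (at r within {0..})"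
      using DERIV_chain2[OF DERIV_phi[OF p] der[of r]] that by simp
    from DERIV_diff[OF this DERIV_ident] show ?thesis
      using pos[OF p] by simp
  qed
  from has_field_derivative_zero_constant[OF _ this]
  obtain c where c: "\<And>r. 0 \<le> r \<Longrightarrow> phi \<psi> (u r l) - r = c"
    by auto
  have "phi \<psi> (u t l) = phi \<psi> l + t"
    using c[of t] c[of 0] u0 t by simp
  with varphi_phi[OF cumulant_pos[OF u l t]] show ?thesis by simp
qed

end

section \<open>Decay of the survival probability\<close>

context critical_or_subcritical
begin

text \<open>The logarithmic derivative of \<open>varphi\<close> is \<open>- \<psi>(varphi)/varphi\<close>, which tends to \<open>- \<alpha>\<close>; the mean
  value theorem turns this into a statement about increments over a fixed time \<open>a\<close>.\<close>

lemma varphi_ratio: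
  assumes "0 < a"
  shows "((\<lambda>t. varphi \<psi> (t + a) / varphi \<psi> t) \<longlongrightarrow> exp (- \<alpha> * a)) at_top"
proof -
  let ?G = "\<lambda>t. \<psi> (varphi \<psi> t) / varphi \<psi> t"
  have "\<exists>\<xi>>t. ln (varphi \<psi> (t + a)) - ln (varphi \<psi> t) = a * - ?G \<xi>" if "0 < t" for t
  proof -
    have "DERIV (\<lambda>t. ln (varphi \<psi> t)) r :> - ?G r" if "t \<le> r" for r
      using DERIV_chain2[OF DERIV_ln_divide[OF varphi_pos] DERIV_varphi, of r] that \<open>0 < t\<close> by simp
    then have "\<exists>z>t. z < t + a \<and> ln (varphi \<psi> (t + a)) - ln (varphi \<psi> t) = (t + a - t) * - ?G z"
      using assms by (intro MVT2) auto
    then show ?thesis by auto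
  qed
  then obtain \<xi> where \<xi>: "\<And>t. 0 < t \<Longrightarrow> t < \<xi> t"
      "\<And>t. 0 < t \<Longrightarrow> ln (varphi \<psi> (t + a)) - ln (varphi \<psi> t) = a * - ?G (\<xi> t)"
    by metis
  have "filterlim \<xi> at_top at_top"
    by (rule filterlim_at_top_mono[OF filterlim_ident])
       (use \<xi>(1) in \<open>auto intro!: eventually_mono[OF eventually_gt_at_top[of 0]] less_imp_le\<close>)
  then have "((\<lambda>t. exp (a * - ?G (\<xi> t))) \<longlongrightarrow> exp (a * - \<alpha>)) at_top"
    by (intro tendsto_intros filterlim_compose[OF slope] filterlim_compose[OF varphi_at_top])
  moreover have "\<forall>\<^sub>F t in at_top. exp (a * - ?G (\<xi> t)) = varphi \<psi> (t + a) / varphi \<psi> t"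
    using eventually_gt_at_top[of 0]
  proof eventually_elim
    case (elim t)
    then show ?case
      using varphi_pos[of t] varphi_pos[of "t + a"] assms
      unfolding \<xi>(2)[OF elim, symmetric] by (simp add: exp_diff)
  qed
  ultimately have "((\<lambda>t. varphi \<psi> (t + a) / varphi \<psi> t) \<longlongrightarrow> exp (a * - \<alpha>)) at_top"
    by (rule Lim_transform_eventually)
  then show ?thesis by (simp add: mult.commute)
qed

lemma increment_subcritical:
  assumes "0 < a"
  shows "((\<lambda>t. (exp (- x * varphi \<psi> (t + a)) - exp (- x * varphi \<psi> t)) / varphi \<psi> t)
           \<longlongrightarrow> x * (1 - exp (- \<alpha> * a))) at_top"
proof -
  let ?q = "\<lambda>y. (1 - exp (- x * y)) / y"
  have "((\<lambda>y. 1 - exp (- x * y)) has_real_derivative x) (at 0)"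
    by (auto intro!: derivative_eq_intros)
  then have "(?q \<longlongrightarrow> x) (at 0)"
    by (simp add: has_field_derivative_iff)
  then have "(?q \<longlongrightarrow> x) (at_right 0)"
    by (rule tendsto_within_subset) simp
  then have q: "((\<lambda>t. ?q (varphi \<psi> t)) \<longlongrightarrow> x) at_top"
    by (rule filterlim_compose[OF _ varphi_at_top])
  have "filterlim (\<lambda>t. t + a) at_top at_top"
    by (rule filterlim_at_top_mono[OF filterlim_ident]) (use assms in auto)
  then have "((\<lambda>t. ?q (varphi \<psi> (t + a))) \<longlongrightarrow> x) at_top"
    by (rule filterlim_compose[OF q])
  with q have "((\<lambda>t. ?q (varphi \<psi> t) - ?q (varphi \<psi> (t + a)) * (varphi \<psi> (t + a) / varphi \<psi> t))
      \<longlongrightarrow> x - x * exp (- \<alpha> * a)) at_top"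
    by (intro tendsto_intros varphi_ratio assms)
  moreover have "\<forall>\<^sub>F t in at_top. ?q (varphi \<psi> t) - ?q (varphi \<psi> (t + a)) * (varphi \<psi> (t + a) / varphi \<psi> t)
      = (exp (- x * varphi \<psi> (t + a)) - exp (- x * varphi \<psi> t)) / varphi \<psi> t"
    using eventually_gt_at_top[of 0]
  proof eventually_elim
    case (elim t)
    then have "?q (varphi \<psi> (t + a)) * (varphi \<psi> (t + a) / varphi \<psi> t)
        = (1 - exp (- x * varphi \<psi> (t + a))) / varphi \<psi> t"
      using varphi_pos[of "t + a"] assms by simp
    then show ?case
      by (simp add: diff_divide_distrib)
  qed
  ultimately have "((\<lambda>t. (exp (- x * varphi \<psi> (t + a)) - exp (- x * varphi \<psi> t)) / varphi \<psi> t)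
           \<longlongrightarrow> x - x * exp (- \<alpha> * a)) at_top"
    by (rule Lim_transform_eventually)
  then show ?thesis by (simp add: right_diff_distrib)
qed

text \<open>By the mean value theorem the increment is \<open>x a \<psi>(w) e\<^bsup>- x w\<^esup>\<close> for some \<open>w\<close> between
  \<open>z = varphi (t + a)\<close> and \<open>y = varphi t\<close>. It remains to see that \<open>\<psi>(z)/\<psi>(y) \<rightarrow> 1\<close>: a second use of
  the mean value theorem gives \<open>y - z \<le> a \<psi>(y)\<close>, and then \<open>slope_bound\<close> gives
  \<open>\<psi>(y) - \<psi>(z) \<le> a \<psi>(y) \<psi>(2 y)/y\<close>, where \<open>\<psi>(2 y)/y \<rightarrow> 2 \<alpha> = 0\<close>.\<close>

lemma increment_critical:
  assumes \<alpha>: "\<alpha> = 0" and x: "0 < x" and a: "0 < a"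
  shows "((\<lambda>t. (exp (- x * varphi \<psi> (t + a)) - exp (- x * varphi \<psi> t)) / \<psi> (varphi \<psi> t))
           \<longlongrightarrow> x * a) at_top"
proof (rule tendsto_sandwich)
  let ?F = "\<lambda>t. exp (- x * varphi \<psi> t)"
  let ?lower = "\<lambda>t. x * a * (1 - a * (\<psi> (2 * varphi \<psi> t) / varphi \<psi> t)) * ?F t"
  have bounds: "?lower t \<le> (?F (t + a) - ?F t) / \<psi> (varphi \<psi> t) \<and>
      (?F (t + a) - ?F t) / \<psi> (varphi \<psi> t) \<le> x * a" if t: "0 < t" for t
  proof -
    define y where "y = varphi \<psi> t"
    define z where "z = varphi \<psi> (t + a)"
    have y: "0 < y" and z: "0 < z"
      using t a by (auto simp: y_def z_def varphi_pos)
    have py: "0 < \<psi> y" by (rule pos[OF y])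
    have "DERIV ?F r :> ?F r * (- x * - \<psi> (varphi \<psi> r))" if "t \<le> r" for r
      using that t by (intro DERIV_chain2[OF DERIV_exp] DERIV_cmult DERIV_varphi) auto
    then have "\<exists>\<xi>>t. \<xi> < t + a \<and> ?F (t + a) - ?F t = (t + a - t) * (?F \<xi> * (- x * - \<psi> (varphi \<psi> \<xi>)))"
      using a by (intro MVT2) auto
    then obtain \<xi> where \<xi>: "t < \<xi>" "\<xi> < t + a"
        "?F (t + a) - ?F t = (t + a - t) * (?F \<xi> * (- x * - \<psi> (varphi \<psi> \<xi>)))"
      by blast
    have "\<exists>\<eta>>t. \<eta> < t + a \<and> varphi \<psi> (t + a) - varphi \<psi> t = (t + a - t) * - \<psi> (varphi \<psi> \<eta>)"
      using t a by (intro MVT2 DERIV_varphi) auto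
    then obtain \<eta> where \<eta>: "t < \<eta>" "\<eta> < t + a"
        "varphi \<psi> (t + a) - varphi \<psi> t = (t + a - t) * - \<psi> (varphi \<psi> \<eta>)"
      by blast
    define w where "w = varphi \<psi> \<xi>"
    have w: "z \<le> w" "w \<le> y"
      using \<xi> t varphi_strict_antimono[of t \<xi>] varphi_strict_antimono[of \<xi> "t + a"]
      by (auto simp: w_def y_def z_def)
    have e: "?F (t + a) - ?F t = x * a * (\<psi> w * exp (- x * w))"
      using \<xi>(3) by (simp add: w_def)
    have "y - z = a * \<psi> (varphi \<psi> \<eta>)"
      using \<eta>(3) by (simp add: y_def z_def)
    also have "\<dots> \<le> a * \<psi> y"
      using \<eta> t a varphi_strict_antimono[of t \<eta>]
      by (intro mult_left_mono psi_mono) (auto simp: y_def varphi_pos)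
    finally have yz: "y - z \<le> a * \<psi> y" .
    have "\<psi> y - \<psi> z \<le> (y - z) * (\<psi> (2 * y) / y)"
      using w z by (intro slope_bound) auto
    also have "\<dots> \<le> a * \<psi> y * (\<psi> (2 * y) / y)"
      using yz y pos[of "2 * y"] by (intro mult_right_mono) auto
    finally have "\<psi> y * (1 - a * (\<psi> (2 * y) / y)) \<le> \<psi> z"
      by (simp add: algebra_simps)
    also have "\<psi> z \<le> \<psi> w"
      using w z by (intro psi_mono)
    finally have low: "(1 - a * (\<psi> (2 * y) / y)) \<le> \<psi> w / \<psi> y"
      using py by (simp add: pos_le_divide_eq mult.commute)
    have up: "\<psi> w / \<psi> y \<le> 1"
      using py w z psi_mono[of w y] by simp
    have pw: "0 \<le> \<psi> w / \<psi> y"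
      using py pos[of w] w z by simp
    have "(1 - a * (\<psi> (2 * y) / y)) * exp (- x * y) \<le> \<psi> w / \<psi> y * exp (- x * y)"
      using low by (intro mult_right_mono) auto
    also have "\<dots> \<le> \<psi> w / \<psi> y * exp (- x * w)"
      using pw w x by (intro mult_left_mono) auto
    finally have L: "x * a * ((1 - a * (\<psi> (2 * y) / y)) * exp (- x * y)) \<le> x * a * (\<psi> w / \<psi> y * exp (- x * w))"
      using x a by (intro mult_left_mono) auto
    have "\<psi> w / \<psi> y * exp (- x * w) \<le> 1 * 1"
      using up x w z by (intro mult_mono) auto
    then have U: "x * a * (\<psi> w / \<psi> y * exp (- x * w)) \<le> x * a * 1"
      using x a by (intro mult_left_mono) auto
    have D: "(?F (t + a) - ?F t) / \<psi> (varphi \<psi> t) = x * a * (\<psi> w / \<psi> y * exp (- x * w))"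
      unfolding e by (simp add: y_def)
    show ?thesis
      unfolding D using L U by (simp only: y_def mult.assoc mult_1_right simp_thms)
  qed
  show "\<forall>\<^sub>F t in at_top. ?lower t \<le> (?F (t + a) - ?F t) / \<psi> (varphi \<psi> t)"
    using eventually_gt_at_top[of 0] by eventually_elim (rule bounds[THEN conjunct1])
  show "\<forall>\<^sub>F t in at_top. (?F (t + a) - ?F t) / \<psi> (varphi \<psi> t) \<le> x * a"
    using eventually_gt_at_top[of 0] by eventually_elim (rule bounds[THEN conjunct2])
  have v: "(varphi \<psi> \<longlongrightarrow> 0) at_top"
    using varphi_at_top by (simp add: filterlim_at)
  have "filterlim (\<lambda>t. 2 * varphi \<psi> t) (at_right 0) at_top"
    unfolding filterlim_at
  proof
    show "\<forall>\<^sub>F t in at_top. 2 * varphi \<psi> t \<in> {0<..} \<and> 2 * varphi \<psi> t \<noteq> 0"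
      using eventually_gt_at_top[of 0] by eventually_elim (use varphi_pos in force)
    show "((\<lambda>t. 2 * varphi \<psi> t) \<longlongrightarrow> 0) at_top"
      using tendsto_mult[OF tendsto_const[of 2] v] by simp
  qed
  then have "((\<lambda>t. 2 * (\<psi> (2 * varphi \<psi> t) / (2 * varphi \<psi> t))) \<longlongrightarrow> 2 * \<alpha>) at_top"
    by (intro tendsto_intros filterlim_compose[OF slope])
  then have "((\<lambda>t. \<psi> (2 * varphi \<psi> t) / varphi \<psi> t) \<longlongrightarrow> 0) at_top"
    using \<alpha> by simp
  then have "(?lower \<longlongrightarrow> x * a * (1 - a * 0) * exp (- x * 0)) at_top"
    by (intro tendsto_intros v)
  then show "(?lower \<longlongrightarrow> x * a) at_top" by simp
qed simp

lemma extinction_ratio_limit: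
  assumes x: "0 < x" and a: "0 < a" and s: "0 < s" and \<alpha>: "0 \<le> \<alpha>"
  shows "((\<lambda>t. (exp (- x * varphi \<psi> (t + a)) - exp (- x * varphi \<psi> t)) /
               (exp (- x * varphi \<psi> (t + s)) - exp (- x * varphi \<psi> t)))
           \<longlongrightarrow> (if \<alpha> > 0 then (1 - exp (- \<alpha> * a)) / (1 - exp (- \<alpha> * s)) else a / s)) at_top"
    (is "((\<lambda>t. ?D a t / ?D s t) \<longlongrightarrow> ?L) at_top")
proof -
  have cancel: "((\<lambda>t. ?D a t / ?D s t) \<longlongrightarrow> p / q) at_top"
    if lim: "((\<lambda>t. ?D a t / h t) \<longlongrightarrow> p) at_top" "((\<lambda>t. ?D s t / h t) \<longlongrightarrow> q) at_top"
      and q: "q \<noteq> 0" and h: "\<And>t. 0 < t \<Longrightarrow> h t \<noteq> 0" for h :: "real \<Rightarrow> real" and p q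
  proof -
    have "((\<lambda>t. (?D a t / h t) / (?D s t / h t)) \<longlongrightarrow> p / q) at_top"
      by (intro tendsto_divide lim q)
    moreover have "\<forall>\<^sub>F t in at_top. (?D a t / h t) / (?D s t / h t) = ?D a t / ?D s t"
      using eventually_gt_at_top[of 0] by eventually_elim (simp add: h)
    ultimately show ?thesis by (rule Lim_transform_eventually)
  qed
  show ?thesis
  proof (cases "\<alpha> > 0")
    case True
    have "((\<lambda>t. ?D a t / ?D s t) \<longlongrightarrow> (x * (1 - exp (- \<alpha> * a))) / (x * (1 - exp (- \<alpha> * s)))) at_top"
      using True x s
      by (intro cancel[of "varphi \<psi>"] increment_subcritical a s) (auto dest: varphi_pos)
    then show ?thesis using True x by simp
  next
    case False
    then have 0: "\<alpha> = 0" using \<alpha> by simp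
    have "((\<lambda>t. ?D a t / ?D s t) \<longlongrightarrow> (x * a) / (x * s)) at_top"
      using x s by (intro cancel[of "\<lambda>t. \<psi> (varphi \<psi> t)"] increment_critical a s x 0)
        (simp_all add: less_imp_neq[OF pos, symmetric] varphi_pos)
    then show ?thesis using False x by simp
  qed
qed

end

section \<open>Conditioning on the extinction window\<close>

locale cb_process_of_mechanism = critical_or_subcritical \<psi> \<alpha> + cb_process \<psi> M P Z
  for \<psi> :: "real \<Rightarrow> real" and \<alpha> :: real and M :: "'a measure"
    and P :: "real \<Rightarrow> 'a measure" and Z :: "real \<Rightarrow> 'a \<Rightarrow> real"
begin

lemma space_P: "0 \<le> x \<Longrightarrow> space (P x) = space M"
  using sets_eq_imp_space_eq[OF sets_P] .

lemma Z_measurable_P: "0 \<le> x \<Longrightarrow> 0 \<le> t \<Longrightarrow> Z t \<in> borel_measurable (P x)"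
  using measurable_Z measurable_cong_sets[OF sets_P refl] by blast

lemma integrable_bounded_P:
  fixes f :: "'a \<Rightarrow> real"
  assumes "0 \<le> x" "f \<in> borel_measurable (P x)" "\<And>\<omega>. \<omega> \<in> space M \<Longrightarrow> \<bar>f \<omega>\<bar> \<le> 1"
  shows "integrable (P x) f"
proof -
  interpret prob_space "P x" by (rule prob_P[OF assms(1)])
  show ?thesis
    using assms by (intro integrable_const_bound[where B = 1]) (auto intro!: AE_I2 simp: space_P)
qed

lemma laplace_varphi:
  assumes "0 \<le> x" "0 < l" "0 \<le> t"
  shows "(LINT \<omega>|P x. exp (- l * Z t \<omega>)) = exp (- x * varphi \<psi> (phi \<psi> l + t))"
proof -
  obtain u where "cumulant \<psi> u"
      "\<forall>x\<ge>0. \<forall>l>0. \<forall>t\<ge>0. (LINT \<omega>|P x. exp (- l * Z t \<omega>)) = exp (- x * u t l)"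
    using laplace by blast
  then show ?thesis using assms cumulant_eq by simp
qed

text \<open>The integral of \<open>e\<^bsup>- n Z\<^esup>\<close> tends to the probability of \<open>{Z = 0}\<close>, while \<open>\<phi>(n) \<rightarrow> 0\<close> in the explicit
  Laplace transform.\<close>

lemma integral_absorbed:
  assumes x: "0 \<le> x" and t: "0 < t"
  shows "(LINT \<omega>|P x. indicator {0} (Z t \<omega>)) = exp (- x * varphi \<psi> t)"
proof -
  interpret prob_space "P x" by (rule prob_P[OF x])
  note [measurable] = Z_measurable_P[OF x, of t] 
  have "(\<lambda>n. LINT \<omega>|P x. exp (- real (Suc n) * Z t \<omega>)) \<longlonglongrightarrow> (LINT \<omega>|P x. indicator {0} (Z t \<omega>))"
  proof (rule integral_dominated_convergence[where w = "\<lambda>_. 1"])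
    show "AE \<omega> in P x. (\<lambda>n. exp (- real (Suc n) * Z t \<omega>)) \<longlonglongrightarrow> indicator {0} (Z t \<omega>)"
    proof (rule AE_I2)
      fix \<omega> assume "\<omega> \<in> space (P x)"
      then have "0 \<le> Z t \<omega>" using Z_nonneg[of t \<omega>] t by (simp add: space_P[OF x])
      then consider "Z t \<omega> = 0" | "0 < Z t \<omega>" by linarith
      then show "(\<lambda>n. exp (- real (Suc n) * Z t \<omega>)) \<longlonglongrightarrow> indicator {0} (Z t \<omega>)"
      proof cases
        case 2
        have "exp (- real (Suc n) * Z t \<omega>) = exp (- Z t \<omega>) ^ Suc n" for n
          using exp_of_nat_mult[of "Suc n" "- Z t \<omega>"] by (simp only: mult_minus_left mult_minus_right)
        moreover have "(\<lambda>n. exp (- Z t \<omega>) ^ Suc n) \<longlonglongrightarrow> 0"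
          using 2 by (intro LIMSEQ_Suc LIMSEQ_realpow_zero) auto
        ultimately show ?thesis using 2 by simp
      qed simp
    qed
    show "AE \<omega> in P x. norm (exp (- real (Suc n) * Z t \<omega>)) \<le> 1" for n
    proof (rule AE_I2)
      fix \<omega> assume "\<omega> \<in> space (P x)"
      then have "0 \<le> Z t \<omega>" using Z_nonneg[of t \<omega>] t by (simp add: space_P[OF x])
      then have "0 \<le> real (Suc n) * Z t \<omega>" by simp
      then show "norm (exp (- real (Suc n) * Z t \<omega>)) \<le> 1"
        by (simp del: of_nat_Suc)
    qed
  qed (use t in \<open>auto intro!: borel_measurable_indicator' simp: less_imp_le\<close>)
  moreover have "(\<lambda>n. LINT \<omega>|P x. exp (- real (Suc n) * Z t \<omega>)) \<longlonglongrightarrow> exp (- x * varphi \<psi> t)"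
  proof -
    have "filterlim (\<lambda>n. real (Suc n)) at_top sequentially"
      by (rule filterlim_compose[OF filterlim_real_sequentially filterlim_Suc])
    then have "(\<lambda>n. phi \<psi> (real (Suc n)) + t) \<longlonglongrightarrow> 0 + t"
      by (intro tendsto_intros filterlim_compose[OF phi_at_top])
    then have "(\<lambda>n. varphi \<psi> (phi \<psi> (real (Suc n)) + t)) \<longlonglongrightarrow> varphi \<psi> t"
      using isCont_tendsto_compose[OF isCont_varphi[OF t]] by simp
    then have "(\<lambda>n. exp (- x * varphi \<psi> (phi \<psi> (real (Suc n)) + t))) \<longlonglongrightarrow> exp (- x * varphi \<psi> t)"
      by (intro tendsto_intros)
    moreover have "(LINT \<omega>|P x. exp (- real (Suc n) * Z t \<omega>)) = exp (- x * varphi \<psi> (phi \<psi> (real (Suc n)) + t))" for n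
      using x t by (intro laplace_varphi) auto
    ultimately show ?thesis by simp
  qed
  ultimately show ?thesis
    by (rule LIMSEQ_unique)
qed

lemma prob_absorbed:
  assumes x: "0 \<le> x" and t: "0 < t"
  shows "measure (P x) {\<omega> \<in> space M. Z t \<omega> = 0} = exp (- x * varphi \<psi> t)"
proof -
  have "(LINT \<omega>|P x. indicator {0} (Z t \<omega>)) = (LINT \<omega>|P x. indicator {\<omega> \<in> space M. Z t \<omega> = 0} \<omega>)"
    by (intro Bochner_Integration.integral_cong) (auto simp: indicator_def space_P[OF x])
  also have "\<dots> = measure (P x) ({\<omega> \<in> space M. Z t \<omega> = 0} \<inter> space (P x))"
    by (rule Bochner_Integration.integral_indicator)
  also have "{\<omega> \<in> space M. Z t \<omega> = 0} \<inter> space (P x) = {\<omega> \<in> space M. Z t \<omega> = 0}"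
    by (auto simp: space_P[OF x])
  finally show ?thesis using integral_absorbed[OF x t] by simp
qed

lemma filtration_natural: "filtration (space M) (natural_filtration M Z)"
proof
  fix i j :: ennreal
  let ?G = "\<lambda>i. {Z s -` B \<inter> space M | s B. 0 \<le> s \<and> ennreal s \<le> i \<and> B \<in> sets borel}"
  have G: "?G i \<subseteq> Pow (space M)" for i by auto
  show "space (natural_filtration M Z i) = space M"
    unfolding natural_filtration_def by (rule space_measure_of[OF G])
  assume "i \<le> j"
  then have "?G i \<subseteq> ?G j" by (blast intro: order_trans)
  then show "sets (natural_filtration M Z i) \<subseteq> sets (natural_filtration M Z j)"
    unfolding natural_filtration_def sets_measure_of[OF G] by (rule sigma_sets_mono')
qed

lemma sets_natural_filtration: "sets (natural_filtration M Z i) \<subseteq> sets M"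
proof -
  let ?G = "{Z s -` B \<inter> space M | s B. 0 \<le> s \<and> ennreal s \<le> i \<and> B \<in> sets borel}"
  have G: "?G \<subseteq> Pow (space M)" by auto
  have "?G \<subseteq> sets M" using measurable_Z by (auto intro: measurable_sets)
  then show ?thesis
    unfolding natural_filtration_def sets_measure_of[OF G] by (rule sets.sigma_sets_subset)
qed

lemma natural_filtrationI:
  assumes "0 \<le> s" "ennreal s \<le> i" "B \<in> sets borel"
  shows "Z s -` B \<inter> space M \<in> sets (natural_filtration M Z i)"
  unfolding natural_filtration_def using assms
  by (intro in_measure_of) auto

text \<open>From state \<open>z\<close> the process is absorbed within time \<open>s\<close> with probability
  \<open>exp (- z varphi(s))\<close>. Conditioning on the past up to the constant stopping time \<open>t\<close> therefore
  multiplies \<open>e\<^bsup>- l Z\<^esup>\<close> by an exponential of the same kind.\<close>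

lemma markov_absorbed:
  assumes x: "0 \<le> x" and t: "0 \<le> t" and s: "0 < s" and l: "0 < l"
  shows "(LINT \<omega>|P x. exp (- l * Z t \<omega>) * indicator {0} (Z (t + s) \<omega>))
         = exp (- x * varphi \<psi> (phi \<psi> (l + varphi \<psi> s) + t))"
proof -
  let ?F = "natural_filtration M Z" and ?T = "\<lambda>_ :: 'a. ennreal t"
  let ?f = "indicator {0} :: real \<Rightarrow> real"
  interpret F: filtration "space M" ?F by (rule filtration_natural)
  interpret prob_space "P x" by (rule prob_P[OF x])
  have T: "stopping_time ?F ?T" by (rule stopping_time_const)
  let ?G = "F.pre_sigma ?T"
  \<comment> \<open>\<open>T\<close> is the constant \<open>t\<close>, so \<open>A \<inter> {T \<le> t}\<close>, which lies in the filtration at time \<open>t\<close>, is \<open>A\<close> itself\<close>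
  have sub: "subalgebra (P x) ?G"
    unfolding subalgebra_def
  proof
    show "space ?G = space (P x)" by (simp add: F.space_pre_sigma space_P[OF x])
    show "sets ?G \<subseteq> sets (P x)"
    proof
      fix A assume "A \<in> sets ?G"
      from F.sets_pre_sigmaD[OF T this, of "ennreal t"] have "A \<in> sets (?F (ennreal t))" by simp
      then show "A \<in> sets (P x)"
        using sets_natural_filtration sets_P[OF x] by auto
    qed
  qed
  interpret finite_measure_subalgebra "P x" ?G
    by unfold_locales (rule sub)
  have Zt: "Z t \<in> borel_measurable ?G"
  proof (rule measurableI)
    fix B :: "real set" assume B: "B \<in> sets borel"
    show "Z t -` B \<inter> space ?G \<in> sets ?G"
    proof (rule F.sets_pre_sigmaI[OF T])
      fix i
      show "{\<omega> \<in> Z t -` B \<inter> space ?G. ennreal t \<le> i} \<in> sets (?F i)"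
      proof (cases "ennreal t \<le> i")
        case True
        then have "{\<omega> \<in> Z t -` B \<inter> space ?G. ennreal t \<le> i} = Z t -` B \<inter> space M"
          by (auto simp: F.space_pre_sigma)
        then show ?thesis using natural_filtrationI[OF t True B] by simp
      qed simp
    qed
  qed simp
  note [measurable] = Z_measurable_P[OF x t] Z_measurable_P[OF x, of "t + s"]
  have ts: "0 \<le> t + s" using t s by simp
  let ?g = "\<lambda>\<omega>. ?f (Z (enn2real (ennreal t) + s) \<omega>)"
  have g: "?g \<in> borel_measurable (P x)"
    using t ts by simp
  have expZ: "\<bar>exp (- k * Z t \<omega>)\<bar> \<le> 1" if "\<omega> \<in> space M" "0 < k" for \<omega> k
    using Z_nonneg[OF t that(1)] that(2) by simp
  have "(LINT \<omega>|P x. exp (- l * Z t \<omega>) * real_cond_exp (P x) ?G ?g \<omega>)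
      = (LINT \<omega>|P x. exp (- l * Z t \<omega>) * ?g \<omega>)"
  proof (rule real_cond_exp_intg(2)[OF _ _ g])
    show "integrable (P x) (\<lambda>\<omega>. exp (- l * Z t \<omega>) * ?g \<omega>)"
      using expZ[OF _ l] g by (intro integrable_bounded_P[OF x]) (auto simp: indicator_def)
  qed (use Zt in measurable)
  moreover have "(LINT \<omega>|P x. exp (- l * Z t \<omega>) * real_cond_exp (P x) ?G ?g \<omega>)
      = (LINT \<omega>|P x. exp (- (l + varphi \<psi> s) * Z t \<omega>))"
  proof (rule integral_cong_AE)
    have "AE \<omega> in P x. ?T \<omega> < \<infinity> \<longrightarrow> real_cond_exp (P x) ?G ?g \<omega>
        = (LINT \<omega>'|P (Z (enn2real (?T \<omega>)) \<omega>). ?f (Z s \<omega>'))"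
      using s by (intro strong_markov[OF x T]) (auto simp: bounded_iff indicator_def intro!: exI[of _ 1])
    with AE_space show "AE \<omega> in P x. exp (- l * Z t \<omega>) * real_cond_exp (P x) ?G ?g \<omega>
        = exp (- (l + varphi \<psi> s) * Z t \<omega>)"
    proof eventually_elim
      case (elim \<omega>)
      then have "real_cond_exp (P x) ?G ?g \<omega> = (LINT \<omega>'|P (Z t \<omega>). ?f (Z s \<omega>'))"
        using t by simp
      also have "\<dots> = exp (- Z t \<omega> * varphi \<psi> s)"
        using Z_nonneg[OF t, of \<omega>] elim(1) s by (intro integral_absorbed) (auto simp: space_P[OF x])
      finally show ?case
        by (simp add: algebra_simps flip: exp_add)
    qed
  qed measurable
  moreover have "(LINT \<omega>|P x. exp (- (l + varphi \<psi> s) * Z t \<omega>))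
      = exp (- x * varphi \<psi> (phi \<psi> (l + varphi \<psi> s) + t))"
    using x t l varphi_pos[OF s] by (intro laplace_varphi) auto
  ultimately show ?thesis using t by simp
qed

definition extinct_before :: "real \<Rightarrow> 'a set" where
  "extinct_before t = {\<omega> \<in> space M. extinction_time Z \<omega> < ennreal t}"

lemma extinct_before_iff:
  "\<omega> \<in> extinct_before t \<longleftrightarrow> \<omega> \<in> space M \<and> (\<exists>r. 0 < r \<and> r < t \<and> Z r \<omega> = 0)"
  unfolding extinct_before_def extinction_time_def by (auto simp: INF_less_iff ennreal_less_iff)

lemma minus_fraction_pos:
  assumes "0 < (t :: real)"
  shows "0 < t - t / real (n + 2)"
proof -
  have "t * 1 < t * real (n + 2)"
    using assms by (intro mult_strict_left_mono) auto
  then show ?thesis by (simp add: pos_divide_less_eq del: of_nat_add)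
qed

text \<open>Absorption makes the uncountable union over \<open>r < t\<close> monotone, so a sequence increasing to \<open>t\<close>
  suffices. The offset \<open>2\<close> keeps all its members in \<open>(0, t)\<close>.\<close>

lemma extinct_before_eq_Union:
  assumes t: "0 < t"
  shows "extinct_before t = (\<Union>n. {\<omega> \<in> space M. Z (t - t / real (n + 2)) \<omega> = 0})"
proof (intro equalityI subsetI)
  fix \<omega> assume "\<omega> \<in> extinct_before t"
  then obtain r where \<omega>: "\<omega> \<in> space M" and r: "0 < r" "r < t" "Z r \<omega> = 0"
    by (auto simp: extinct_before_iff)
  obtain n where n: "t / (t - r) < real n"
    using reals_Archimedean2 by blast
  then have "t < real n * (t - r)"
    using r by (simp add: pos_divide_less_eq)
  also have "\<dots> \<le> real (n + 2) * (t - r)"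
    using r by (intro mult_right_mono) auto
  finally have "t / real (n + 2) \<le> t - r"
    by (simp add: pos_divide_le_eq mult.commute)
  then have "Z (t - t / real (n + 2)) \<omega> = 0"
    using r \<omega> absorbed[of r "t - t / real (n + 2)" \<omega>] by simp
  then show "\<omega> \<in> (\<Union>n. {\<omega> \<in> space M. Z (t - t / real (n + 2)) \<omega> = 0})"
    using \<omega> by blast
next
  fix \<omega> assume "\<omega> \<in> (\<Union>n. {\<omega> \<in> space M. Z (t - t / real (n + 2)) \<omega> = 0})"
  then obtain n where n: "\<omega> \<in> space M" "Z (t - t / real (n + 2)) \<omega> = 0"
    by blast
  moreover have "0 < t - t / real (n + 2)" "t - t / real (n + 2) < t"
    using t minus_fraction_pos[OF t] by auto
  ultimately show "\<omega> \<in> extinct_before t"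
    unfolding extinct_before_iff by blast
qed

lemma sets_absorbed: "0 \<le> x \<Longrightarrow> 0 \<le> t \<Longrightarrow> {\<omega> \<in> space M. Z t \<omega> = 0} \<in> sets (P x)"
  using measurable_sets[OF Z_measurable_P, of x t "{0}"]
  by (simp add: vimage_def space_P Int_def conj_commute)

text \<open>Both events have the same probability, since \<open>r \<mapsto> P\<^sub>x(Z\<^sub>r = 0)\<close> is continuous and
  \<open>{\<zeta> < t}\<close> is the increasing union of the events \<open>{Z\<^sub>r = 0}\<close>, \<open>r < t\<close>; one contains the other.\<close>

lemma extinct_before_AE:
  assumes x: "0 \<le> x" and t: "0 < t"
  shows "extinct_before t \<in> sets (P x)"
    and "AE \<omega> in P x. \<omega> \<in> extinct_before t \<longleftrightarrow> Z t \<omega> = 0"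
proof -
  interpret prob_space "P x" by (rule prob_P[OF x])
  let ?r = "\<lambda>n. t - t / real (n + 2)"
  let ?A = "\<lambda>n. {\<omega> \<in> space M. Z (?r n) \<omega> = 0}"
  let ?B = "{\<omega> \<in> space M. Z t \<omega> = 0}"
  have r: "0 < ?r n" for n
    using t by (rule minus_fraction_pos)
  have A: "?A n \<in> sets (P x)" for n
    using r[of n] by (intro sets_absorbed x) auto
  have B: "?B \<in> sets (P x)"
    using t by (intro sets_absorbed x) auto
  show E: "extinct_before t \<in> sets (P x)"
    unfolding extinct_before_eq_Union[OF t] using A by auto
  have sub: "extinct_before t \<subseteq> ?B"
  proof
    fix \<omega> assume "\<omega> \<in> extinct_before t"
    then obtain r where "\<omega> \<in> space M" "0 < r" "r < t" "Z r \<omega> = 0"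
      by (auto simp: extinct_before_iff)
    then show "\<omega> \<in> ?B" using absorbed[of r t \<omega>] by simp
  qed
  have "incseq ?A"
  proof (rule incseq_SucI, rule subsetI)
    fix n \<omega> assume "\<omega> \<in> ?A n"
    moreover have "?r n \<le> ?r (Suc n)"
      using t by (simp add: frac_le)
    ultimately show "\<omega> \<in> ?A (Suc n)"
      using r[of n] absorbed[of "?r n" "?r (Suc n)" \<omega>] by simp
  qed
  then have "(\<lambda>n. measure (P x) (?A n)) \<longlonglongrightarrow> measure (P x) (extinct_before t)"
    unfolding extinct_before_eq_Union[OF t] using A by (intro finite_Lim_measure_incseq) auto
  moreover have "(\<lambda>n. measure (P x) (?A n)) \<longlonglongrightarrow> measure (P x) ?B"
  proof -
    have "(\<lambda>n. t / real (n + 2)) \<longlonglongrightarrow> 0"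
      using LIMSEQ_ignore_initial_segment[OF lim_const_over_n[of t], of 2] by simp
    then have "?r \<longlonglongrightarrow> t - 0"
      by (intro tendsto_intros)
    then have "(\<lambda>n. varphi \<psi> (?r n)) \<longlonglongrightarrow> varphi \<psi> t"
      using isCont_tendsto_compose[OF isCont_varphi[OF t]] by simp
    then have "(\<lambda>n. exp (- x * varphi \<psi> (?r n))) \<longlonglongrightarrow> exp (- x * varphi \<psi> t)"
      by (intro tendsto_intros)
    then show ?thesis
      by (simp only: prob_absorbed[OF x r] prob_absorbed[OF x t])
  qed
  ultimately have "measure (P x) (extinct_before t) = measure (P x) ?B"
    by (rule LIMSEQ_unique)
  then have "measure (P x) (?B - extinct_before t) = 0"
    using finite_measure_Diff[OF B E sub] by simp
  then have "?B - extinct_before t \<in> null_sets (P x)"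
    using B E by (intro null_setsI) (auto simp: emeasure_eq_measure)
  from AE_not_in[OF this] AE_space show "AE \<omega> in P x. \<omega> \<in> extinct_before t \<longleftrightarrow> Z t \<omega> = 0"
    by eventually_elim (use sub in \<open>auto simp: space_P[OF x]\<close>)
qed

text \<open>Up to null sets the indicator of the window is \<open>1\<^bsub>Z(t+s) = 0\<^esub> - 1\<^bsub>Z(t) = 0\<^esub>\<close>, and on
  \<open>{Z\<^sub>t = 0}\<close> the integrand \<open>e\<^bsup>- l Z\<^esup>\<close> is \<open>1\<close>.\<close>

lemma expectation_given_extinction_window:
  assumes x: "0 \<le> x" and t: "0 < t" and s: "0 < s" and l: "0 < l"
  shows "expectation_given_event (P x) (\<lambda>\<omega>. exp (- l * Z t \<omega>))
      {\<omega> \<in> space M. ennreal t \<le> extinction_time Z \<omega> \<and> extinction_time Z \<omega> < ennreal (t + s)}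
    = (exp (- x * varphi \<psi> (t + phi \<psi> (l + varphi \<psi> s))) - exp (- x * varphi \<psi> t)) /
      (exp (- x * varphi \<psi> (t + s)) - exp (- x * varphi \<psi> t))"
    (is "expectation_given_event _ ?e ?A = ?rhs")
proof -
  interpret prob_space "P x" by (rule prob_P[OF x])
  have ts: "0 < t + s" using t s by simp
  note [measurable] = Z_measurable_P[OF x less_imp_le[OF t]] Z_measurable_P[OF x less_imp_le[OF ts]]
  have A: "?A = extinct_before (t + s) - extinct_before t"
    by (auto simp: extinct_before_def not_less)
  have A_sets [measurable]: "?A \<in> sets (P x)"
    unfolding A using extinct_before_AE(1)[OF x] t ts by auto
  have ind: "AE \<omega> in P x. indicator ?A \<omega> = (indicator {0} (Z (t + s) \<omega>) - indicator {0} (Z t \<omega>) :: real)"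
    using extinct_before_AE(2)[OF x t] extinct_before_AE(2)[OF x ts] AE_space
  proof eventually_elim
    case (elim \<omega>)
    then show ?case
      using absorbed[of t "t + s" \<omega>] t s unfolding A by (auto simp: indicator_def space_P[OF x])
  qed
  have i1: "integrable (P x) (\<lambda>\<omega>. indicator {0} (Z r \<omega>) :: real)" if "0 \<le> r" for r
    using Z_measurable_P[OF x that] by (intro integrable_bounded_P[OF x]) (auto simp: indicator_def)
  have i2: "integrable (P x) (\<lambda>\<omega>. exp (- l * Z t \<omega>) * indicator {0} (Z (t + s) \<omega>))"
    using Z_nonneg[of t] t l by (intro integrable_bounded_P[OF x]) (auto simp: indicator_def)
  have "measure (P x) ?A = (LINT \<omega>|P x. indicator ?A \<omega>)"
    using A_sets sets.sets_into_space[OF A_sets] by (simp add: Int_absorb2)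
  also have "\<dots> = (LINT \<omega>|P x. indicator {0} (Z (t + s) \<omega>) - indicator {0} (Z t \<omega>))"
    by (rule integral_cong_AE[OF _ _ ind]) measurable
  also have "\<dots> = exp (- x * varphi \<psi> (t + s)) - exp (- x * varphi \<psi> t)"
    using t ts by (simp add: i1 integral_absorbed[OF x])
  finally have denominator: "measure (P x) ?A = \<dots>" .
  have "(LINT \<omega>:?A|P x. ?e \<omega>)
      = (LINT \<omega>|P x. exp (- l * Z t \<omega>) * indicator {0} (Z (t + s) \<omega>) - indicator {0} (Z t \<omega>))"
    unfolding set_lebesgue_integral_def
  proof (rule integral_cong_AE)
    show "AE \<omega> in P x. indicator ?A \<omega> *\<^sub>R ?e \<omega>
        = exp (- l * Z t \<omega>) * indicator {0} (Z (t + s) \<omega>) - indicator {0} (Z t \<omega>)"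
      using ind
    proof eventually_elim
      case (elim \<omega>)
      show ?case unfolding elim by (auto simp: indicator_def)
    qed
  qed measurable
  also have "\<dots> = (LINT \<omega>|P x. exp (- l * Z t \<omega>) * indicator {0} (Z (t + s) \<omega>)) - (LINT \<omega>|P x. indicator {0} (Z t \<omega>))"
    using t by (intro Bochner_Integration.integral_diff i2 i1) simp
  also have "\<dots> = exp (- x * varphi \<psi> (phi \<psi> (l + varphi \<psi> s) + t)) - exp (- x * varphi \<psi> t)"
    unfolding integral_absorbed[OF x t] markov_absorbed[OF x less_imp_le[OF t] s l] ..
  finally show ?thesis
    unfolding expectation_given_event_def denominator by (simp add: add.commute)
qed

lemma conditional_laplace_limit:
  assumes \<alpha>: "0 \<le> \<alpha>" and x: "0 < x" and s: "0 < s" and l: "0 < l"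
  shows "((\<lambda>t. expectation_given_event (P x) (\<lambda>\<omega>. exp (- l * Z t \<omega>))
      {\<omega> \<in> space M. ennreal t \<le> extinction_time Z \<omega> \<and> extinction_time Z \<omega> < ennreal (t + s)})
    \<longlongrightarrow> (if \<alpha> > 0
         then (1 - exp (- \<alpha> * phi \<psi> (l + varphi \<psi> s))) / (1 - exp (- \<alpha> * s))
         else phi \<psi> (l + varphi \<psi> s) / s)) at_top"
proof (rule Lim_transform_eventually)
  have "0 < phi \<psi> (l + varphi \<psi> s)"
    using l varphi_pos[OF s] by (intro phi_pos) auto
  from extinction_ratio_limit[OF x this s \<alpha>]
  show "((\<lambda>t. (exp (- x * varphi \<psi> (t + phi \<psi> (l + varphi \<psi> s))) - exp (- x * varphi \<psi> t)) /
      (exp (- x * varphi \<psi> (t + s)) - exp (- x * varphi \<psi> t)))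
    \<longlongrightarrow> (if \<alpha> > 0
         then (1 - exp (- \<alpha> * phi \<psi> (l + varphi \<psi> s))) / (1 - exp (- \<alpha> * s))
         else phi \<psi> (l + varphi \<psi> s) / s)) at_top" .
  show "\<forall>\<^sub>F t in at_top. (exp (- x * varphi \<psi> (t + phi \<psi> (l + varphi \<psi> s))) - exp (- x * varphi \<psi> t)) /
      (exp (- x * varphi \<psi> (t + s)) - exp (- x * varphi \<psi> t))
    = expectation_given_event (P x) (\<lambda>\<omega>. exp (- l * Z t \<omega>))
      {\<omega> \<in> space M. ennreal t \<le> extinction_time Z \<omega> \<and> extinction_time Z \<omega> < ennreal (t + s)}"
    using eventually_gt_at_top[of 0]
    by (rule eventually_mono)
       (simp only: expectation_given_extinction_window[OF less_imp_le[OF x] _ s l])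
qed

end

section \<open>The limit laws\<close>

lemma nn_integral_exp_tail:
  assumes "0 < r"
  shows "(\<integral>\<^sup>+u. ennreal (exp (- u * r)) * indicator {c..} u \<partial>lborel) = ennreal (exp (- c * r) / r)"
proof -
  have "((\<lambda>u. - (exp (- u * r) / r)) \<longlongrightarrow> - (0 / r)) at_top"
  proof (intro tendsto_intros)
    have "filterlim (\<lambda>u. u * r) at_top at_top"
      using filterlim_tendsto_pos_mult_at_top[OF tendsto_const assms filterlim_ident] by (simp add: mult.commute)
    then show "((\<lambda>u. exp (- u * r)) \<longlongrightarrow> 0) at_top"
      by (intro filterlim_compose[OF exp_at_bot]) (simp add: filterlim_uminus_at_bot)
  qed (use assms in auto)
  then have "(\<integral>\<^sup>+u. ennreal (exp (- u * r)) * indicator {c..} u \<partial>lborel) = ennreal (- (0 / r) - (- (exp (- c * r) / r)))"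
    by (intro nn_integral_FTC_atLeast) (use assms in \<open>auto intro!: derivative_eq_intros simp: field_simps\<close>)
  then show ?thesis by simp
qed

context critical_or_subcritical
begin

lemma scale_function_measurable:
  assumes "scale_function \<psi> W"
  shows "(\<lambda>r. indicator {0<..} r * W r) \<in> borel_measurable borel"
proof -
  have "continuous_on {0<..} W"
    using assms unfolding scale_function_def by (auto intro: continuous_on_subset)
  then have "(\<lambda>r. indicator {0<..} r *\<^sub>R W r) \<in> borel_measurable borel"
    by (intro borel_measurable_continuous_on_indicator) auto
  then show ?thesis by simp
qed

lemma scale_function_laplace:
  assumes W: "scale_function \<psi> W" and u: "0 < u"
  shows "(\<integral>\<^sup>+r. ennreal (exp (- u * r)) * ennreal (indicator {0<..} r * W r) \<partial>lborel) = ennreal (1 / \<psi> u)"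
proof -
  have int: "integrable lborel (\<lambda>r. indicator {0..} r *\<^sub>R (exp (- u * r) * W r))"
    and val: "(LINT r|lborel. indicator {0..} r *\<^sub>R (exp (- u * r) * W r)) = 1 / \<psi> u"
    and nonneg: "\<And>r. 0 \<le> r \<Longrightarrow> 0 \<le> W r"
    using W u by (auto simp: scale_function_def set_integrable_def set_lebesgue_integral_def)
  have "(\<integral>\<^sup>+r. ennreal (exp (- u * r)) * ennreal (indicator {0<..} r * W r) \<partial>lborel)
      = (\<integral>\<^sup>+r. ennreal (indicator {0..} r *\<^sub>R (exp (- u * r) * W r)) \<partial>lborel)"
  proof (rule nn_integral_cong_AE)
    show "AE r in lborel. ennreal (exp (- u * r)) * ennreal (indicator {0<..} r * W r)
        = ennreal (indicator {0..} r *\<^sub>R (exp (- u * r) * W r))"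
      using AE_lborel_singleton[of 0]
      by eventually_elim (auto simp: indicator_def ennreal_mult' nonneg)
  qed
  also have "\<dots> = ennreal (1 / \<psi> u)"
    unfolding val[symmetric]
    by (rule nn_integral_eq_integral[OF int]) (auto simp: indicator_def nonneg)
  finally show ?thesis .
qed

text \<open>Write \<open>e\<^bsup>- c r\<^esup>/r\<close> as the integral of \<open>e\<^bsup>- u r\<^esup>\<close> over \<open>u \<ge> c\<close> and exchange the two
  integrals by Tonelli's theorem.\<close>

lemma scale_function_laplace_div:
  assumes W: "scale_function \<psi> W" and c: "0 < c"
  shows "(\<integral>\<^sup>+r. ennreal (exp (- c * r) / r) * ennreal (indicator {0<..} r * W r) \<partial>lborel) = ennreal (phi \<psi> c)"
proof -
  note [measurable] = scale_function_measurable[OF W]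
  let ?W = "\<lambda>r. ennreal (indicator {0<..} r * W r)"
  have "(\<integral>\<^sup>+r. ennreal (exp (- c * r) / r) * ?W r \<partial>lborel)
      = (\<integral>\<^sup>+r. (\<integral>\<^sup>+u. ennreal (exp (- u * r)) * indicator {c..} u * ?W r \<partial>lborel) \<partial>lborel)"
  proof (rule nn_integral_cong)
    fix r :: real
    have "ennreal (exp (- c * r) / r) * ?W r
        = (\<integral>\<^sup>+u. ennreal (exp (- u * r)) * indicator {c..} u \<partial>lborel) * ?W r"
      by (cases "0 < r") (simp_all only: nn_integral_exp_tail, simp)
    then show "ennreal (exp (- c * r) / r) * ?W r
        = (\<integral>\<^sup>+u. ennreal (exp (- u * r)) * indicator {c..} u * ?W r \<partial>lborel)"
      by (simp add: nn_integral_multc)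
  qed
  also have "\<dots> = (\<integral>\<^sup>+u. (\<integral>\<^sup>+r. ennreal (exp (- u * r)) * indicator {c..} u * ?W r \<partial>lborel) \<partial>lborel)"
    by (rule lborel_pair.Fubini') measurable
  also have "\<dots> = (\<integral>\<^sup>+u. ennreal (indicator {c..} u *\<^sub>R (1 / \<psi> u)) \<partial>lborel)"
  proof (rule nn_integral_cong)
    fix u :: real
    have "(\<integral>\<^sup>+r. ennreal (exp (- u * r)) * indicator {c..} u * ?W r \<partial>lborel)
        = (\<integral>\<^sup>+r. indicator {c..} u * (ennreal (exp (- u * r)) * ?W r) \<partial>lborel)"
      by (simp add: ac_simps)
    also have "\<dots> = indicator {c..} u * (\<integral>\<^sup>+r. ennreal (exp (- u * r)) * ?W r \<partial>lborel)"
      by (rule nn_integral_cmult) measurable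
    also have "\<dots> = ennreal (indicator {c..} u *\<^sub>R (1 / \<psi> u))"
      using c scale_function_laplace[OF W, of u] by (cases "c \<le> u") auto
    finally show "(\<integral>\<^sup>+r. ennreal (exp (- u * r)) * indicator {c..} u * ?W r \<partial>lborel)
        = ennreal (indicator {c..} u *\<^sub>R (1 / \<psi> u))" .
  qed
  also have "\<dots> = ennreal (LINT u|lborel. indicator {c..} u *\<^sub>R (1 / \<psi> u))"
    using c tail_integrable[OF c] pos
    by (intro nn_integral_eq_integral) (auto simp: set_integrable_def indicator_def intro!: less_imp_le)
  also have "(LINT u|lborel. indicator {c..} u *\<^sub>R (1 / \<psi> u)) = phi \<psi> c"
    unfolding phi_def set_lebesgue_integral_def
  proof (rule integral_cong_AE)
    show "AE u in lborel. indicator {c..} u *\<^sub>R (1 / \<psi> u) = indicator {c<..} u *\<^sub>R (1 / \<psi> u)"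
      using AE_lborel_singleton[of c] by eventually_elim (auto simp: indicator_def)
  qed (use tail_integrable[OF c] tail_integrable_open[OF c] in \<open>auto simp: set_integrable_def\<close>)
  finally show ?thesis .
qed

lemma mu_integral:
  assumes W: "scale_function \<psi> W" and s: "0 < s" and l: "0 \<le> l"
  shows "(\<integral>\<^sup>+r. ennreal (exp (- l * r)) \<partial>mu \<psi> W s) = ennreal (phi \<psi> (l + varphi \<psi> s) / s)"
proof -
  note [measurable] = scale_function_measurable[OF W]
  let ?W = "\<lambda>r. indicator {0<..} r * W r" and ?c = "l + varphi \<psi> s"
  have nonneg: "0 \<le> W r" if "0 \<le> r" for r
    using W that by (auto simp: scale_function_def)
  have dens: "indicator {0<..} r * ennreal (exp (- varphi \<psi> s * r) * (W r / (s * r)))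
      = ennreal (exp (- varphi \<psi> s * r) * (?W r / (s * r)))" for r
    by (auto simp: indicator_def)
  have c: "0 < ?c" using l varphi_pos[OF s] by simp
  have "(\<integral>\<^sup>+r. ennreal (exp (- l * r)) \<partial>mu \<psi> W s)
      = (\<integral>\<^sup>+r. ennreal (exp (- varphi \<psi> s * r) * (?W r / (s * r))) * ennreal (exp (- l * r)) \<partial>lborel)"
    unfolding mu_def dens by (rule nn_integral_density) measurable
  also have "\<dots> = (\<integral>\<^sup>+r. ennreal (1 / s) * (ennreal (exp (- ?c * r) / r) * ennreal (?W r)) \<partial>lborel)"
  proof (rule nn_integral_cong)
    fix r :: real
    show "ennreal (exp (- varphi \<psi> s * r) * (?W r / (s * r))) * ennreal (exp (- l * r))
        = ennreal (1 / s) * (ennreal (exp (- ?c * r) / r) * ennreal (?W r))"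
    proof (cases "0 < r")
      case True
      have "exp (- varphi \<psi> s * r) * (?W r / (s * r)) * exp (- l * r) = (1 / s) * ((exp (- ?c * r) / r) * ?W r)"
        by (simp add: distrib_right exp_add[symmetric] exp_diff exp_minus field_simps)
      then show ?thesis
        using True s nonneg[of r] by (simp flip: ennreal_mult)
    qed simp
  qed
  also have "\<dots> = ennreal (1 / s) * ennreal (phi \<psi> ?c)"
    using scale_function_laplace_div[OF W c] by (subst nn_integral_cmult) auto
  also have "\<dots> = ennreal (phi \<psi> ?c / s)"
    using s phi_pos[OF c] by (simp flip: ennreal_mult)
  finally show ?thesis .
qed

end

text \<open>The theorem asks for a random variable that is positive everywhere, whereas the limit laws live
  on the whole real line and charge \<open>(0, \<infinity>)\<close> fully. So the identity is changed on a null set.\<close>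

lemma positive_version_of_identity:
  fixes S :: "real measure"
  assumes sets: "sets S = sets borel" and pos: "AE r in S. 0 < r"
  obtains W where "W \<in> borel_measurable S" "\<And>\<omega>. 0 < W \<omega>" "distr S borel W = S"
    "\<And>l. (LINT \<omega>|S. exp (- l * W \<omega>)) = (LINT r|S. exp (- l * r))"
proof
  let ?W = "\<lambda>r :: real. if 0 < r then r else 1"
  note [measurable_cong] = sets
  show W: "?W \<in> borel_measurable S" by measurable
  have eq: "AE r in S. ?W r = r"
    using pos by eventually_elim simp
  have "distr S borel ?W = distr S S (\<lambda>r. r)"
    by (rule distr_cong_AE) (use eq sets W in auto)
  then show "distr S borel ?W = S"
    by (simp add: distr_id)
  show "(LINT \<omega>|S. exp (- l * ?W \<omega>)) = (LINT r|S. exp (- l * r))" for l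
  proof (rule integral_cong_AE)
    show "AE r in S. exp (- l * ?W r) = exp (- l * r)"
      using eq by eventually_elim simp
  qed measurable
qed simp

context critical_or_subcritical
begin

lemma mu_law:
  assumes W: "scale_function \<psi> W" and s: "0 < s"
  shows "prob_space (mu \<psi> W s)"
    and "sets (mu \<psi> W s) = sets borel"
    and "AE r in mu \<psi> W s. 0 < r"
    and "\<And>l. 0 < l \<Longrightarrow> (LINT r|mu \<psi> W s. exp (- l * r)) = phi \<psi> (l + varphi \<psi> s) / s"
proof -
  note [measurable] = scale_function_measurable[OF W]
  let ?W = "\<lambda>r. indicator {0<..} r * W r"
  have "indicator {0<..} r * ennreal (exp (- varphi \<psi> s * r) * (W r / (s * r)))
      = ennreal (exp (- varphi \<psi> s * r) * (?W r / (s * r)))" for r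
    by (auto simp: indicator_def)
  then have mu: "mu \<psi> W s = density lborel (\<lambda>r. ennreal (exp (- varphi \<psi> s * r) * (?W r / (s * r))))"
    by (simp add: mu_def)
  show sets: "sets (mu \<psi> W s) = sets borel"
    by (simp add: mu_def)
  show "AE r in mu \<psi> W s. 0 < r"
  proof -
    have "(\<lambda>r. ennreal (exp (- varphi \<psi> s * r) * (?W r / (s * r)))) \<in> borel_measurable lborel"
      by measurable
    from AE_density[OF this] show ?thesis
      unfolding mu by (auto intro!: AE_I2 simp: indicator_def)
  qed
  have "(\<integral>\<^sup>+r. 1 \<partial>mu \<psi> W s) = 1"
    using mu_integral[OF W s, of 0] s by (simp add: phi_varphi)
  then show "prob_space (mu \<psi> W s)"
    by (intro prob_spaceI) simp
  fix l :: real assume l: "0 < l"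
  have "(LINT r|mu \<psi> W s. exp (- l * r)) = enn2real (\<integral>\<^sup>+r. ennreal (exp (- l * r)) \<partial>mu \<psi> W s)"
    by (rule integral_eq_nn_integral) (auto simp: mu)
  also have "\<dots> = phi \<psi> (l + varphi \<psi> s) / s"
    using l s varphi_pos[OF s] phi_pos[of "l + varphi \<psi> s"] by (subst mu_integral[OF W s]) auto
  finally show "(LINT r|mu \<psi> W s. exp (- l * r)) = phi \<psi> (l + varphi \<psi> s) / s" .
qed

text \<open>At \<open>l = varphi s\<close> the Laplace transform of the Yaglom law is \<open>1 - e\<^bsup>- \<alpha> s\<^esup>\<close>, because
  \<open>\<phi>(varphi(s)) = s\<close>; this is the normalising constant.\<close>

lemma size_biased_yaglom:
  assumes \<alpha>: "0 < \<alpha>" and \<nu>: "yaglom_distribution \<alpha> \<psi> \<nu>" and s: "0 < s"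
    and c: "c = (LINT r|\<nu>. exp (- varphi \<psi> s * r))"
  defines "S \<equiv> density \<nu> (\<lambda>r. ennreal (exp (- varphi \<psi> s * r) / c))"
  shows "prob_space S"
    and "sets S = sets borel"
    and "AE r in S. 0 < r"
    and "\<And>l. 0 < l \<Longrightarrow> (LINT r|S. exp (- l * r)) = (1 - exp (- \<alpha> * phi \<psi> (l + varphi \<psi> s))) / (1 - exp (- \<alpha> * s))"
proof -
  interpret prob_space \<nu> using \<nu> by (simp add: yaglom_distribution_def)
  have sets[measurable_cong]: "sets \<nu> = sets borel" and pos: "AE r in \<nu>. 0 < r"
    and laplace: "\<And>l. 0 < l \<Longrightarrow> (LINT r|\<nu>. exp (- l * r)) = 1 - exp (- \<alpha> * phi \<psi> l)"
    using \<nu> by (auto simp: yaglom_distribution_def)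
  have c_eq: "c = 1 - exp (- \<alpha> * s)"
    unfolding c using laplace[OF varphi_pos[OF s]] by (simp add: phi_varphi[OF s])
  have c_pos: "0 < c"
    unfolding c_eq using \<alpha> s by simp
  show "sets S = sets borel"
    by (simp add: S_def sets)
  show "AE r in S. 0 < r"
    unfolding S_def by (subst AE_density) (use pos in \<open>auto elim: eventually_mono\<close>)
  have int: "integrable \<nu> (\<lambda>r. exp (- varphi \<psi> s * r))"
    by (rule integrable_const_bound[where B = 1])
       (use pos varphi_pos[OF s] in \<open>auto elim: eventually_mono\<close>)
  have "(\<integral>\<^sup>+r. ennreal (exp (- varphi \<psi> s * r) / c) \<partial>\<nu>) = ennreal (LINT r|\<nu>. exp (- varphi \<psi> s * r) / c)"
    using int c_pos by (intro nn_integral_eq_integral) auto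
  also have "\<dots> = 1"
    unfolding integral_divide_zero c[symmetric] using c_pos by simp
  finally show "prob_space S"
    unfolding S_def by (intro prob_spaceI) (simp add: emeasure_density cong: nn_integral_cong_simp)
  fix l :: real assume l: "0 < l"
  have "(LINT r|S. exp (- l * r)) = (LINT r|\<nu>. (exp (- varphi \<psi> s * r) / c) *\<^sub>R exp (- l * r))"
    unfolding S_def by (rule integral_density) (use c_pos in auto)
  also have "\<dots> = (LINT r|\<nu>. exp (- (l + varphi \<psi> s) * r) / c)"
    by (rule Bochner_Integration.integral_cong) (auto simp: algebra_simps simp flip: exp_add)
  also have "\<dots> = (1 - exp (- \<alpha> * phi \<psi> (l + varphi \<psi> s))) / (1 - exp (- \<alpha> * s))"
    using laplace[of "l + varphi \<psi> s"] l varphi_pos[OF s] by (simp add: c_eq)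
  finally show "(LINT r|S. exp (- l * r)) = \<dots>" .
qed

end

section \<open>Conditional limit theorem\<close>

theorem theorem4p2:
  fixes \<alpha> \<sigma> :: real and \<pi> :: "real measure"
    and M :: "'a measure" and P :: "real \<Rightarrow> 'a measure" and Z :: "real \<Rightarrow> 'a \<Rightarrow> real"
    and W :: "real \<Rightarrow> real"
    and N :: "'b measure" and \<Theta> :: "'b \<Rightarrow> real"
  defines "\<psi> \<equiv> psi \<alpha> \<sigma> \<pi>"
  assumes "branching_mechanism \<alpha> \<sigma> \<pi>"
    and "cb_process \<psi> M P Z"
    and "scale_function \<psi> W"
    and "\<alpha> > 0 \<Longrightarrow> prob_space N \<and> \<Theta> \<in> borel_measurable N \<and>
                   yaglom_distribution \<alpha> \<psi> (distr N borel \<Theta>)"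
  shows "\<forall>s>0. \<exists>(S :: real measure) (W\<^sub>s :: real \<Rightarrow> real).
    prob_space S \<and> W\<^sub>s \<in> borel_measurable S \<and> (\<forall>\<omega>\<in>space S. 0 < W\<^sub>s \<omega>) \<and>
    (\<forall>l>0. \<forall>x>0.
      ((\<lambda>t. expectation_given_event (P x) (\<lambda>\<omega>. exp (- l * Z t \<omega>))
              {\<omega> \<in> space M. ennreal t \<le> extinction_time Z \<omega> \<and> extinction_time Z \<omega> < ennreal (t + s)})
        \<longlongrightarrow> (LINT \<omega>|S. exp (- l * W\<^sub>s \<omega>))) at_top \<and>
      (LINT \<omega>|S. exp (- l * W\<^sub>s \<omega>)) =
        (if \<alpha> > 0
         then (1 - exp (- \<alpha> * phi \<psi> (l + varphi \<psi> s))) / (1 - exp (- \<alpha> * s))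
         else phi \<psi> (l + varphi \<psi> s) / s)) \<and>
    (\<alpha> = 0 \<longrightarrow> distr S borel W\<^sub>s = mu \<psi> W s) \<and>
    (\<alpha> > 0 \<longrightarrow> distr S borel W\<^sub>s =
       density (distr N borel \<Theta>)
         (\<lambda>r. ennreal (exp (- varphi \<psi> s * r) / (LINT \<omega>|N. exp (- varphi \<psi> s * \<Theta> \<omega>)))))"
proof (intro allI impI)
  interpret branching_mechanism \<alpha> \<sigma> \<pi> by fact
  interpret critical_or_subcritical \<psi> \<alpha>
    unfolding \<psi>_def by (rule critical_or_subcritical_psi)
  interpret cb_process \<psi> M P Z by fact
  interpret cb_process_of_mechanism \<psi> \<alpha> M P Z ..
  fix s :: real assume s: "0 < s"
  let ?L = "\<lambda>l. if \<alpha> > 0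
    then (1 - exp (- \<alpha> * phi \<psi> (l + varphi \<psi> s))) / (1 - exp (- \<alpha> * s))
    else phi \<psi> (l + varphi \<psi> s) / s"
  let ?Y = "density (distr N borel \<Theta>)
    (\<lambda>r. ennreal (exp (- varphi \<psi> s * r) / (LINT \<omega>|N. exp (- varphi \<psi> s * \<Theta> \<omega>))))"
  obtain S :: "real measure" where S: "prob_space S" "sets S = sets borel" "AE r in S. 0 < r"
      "\<And>l. 0 < l \<Longrightarrow> (LINT r|S. exp (- l * r)) = ?L l"
    and law: "\<alpha> = 0 \<Longrightarrow> S = mu \<psi> W s" "\<alpha> > 0 \<Longrightarrow> S = ?Y"
  proof (cases "\<alpha> > 0")
    case True
    then have N: "prob_space N" "\<Theta> \<in> borel_measurable N" "yaglom_distribution \<alpha> \<psi> (distr N borel \<Theta>)"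
      using assms(5) by auto
    have "(LINT \<omega>|N. exp (- varphi \<psi> s * \<Theta> \<omega>)) = (LINT r|distr N borel \<Theta>. exp (- varphi \<psi> s * r))"
      using N(2) by (subst integral_distr) auto
    note Y = size_biased_yaglom[OF True N(3) s this]
    show thesis
      by (rule that[of ?Y]) (use Y True in auto)
  next
    case False
    show thesis
      by (rule that[of "mu \<psi> W s"]) (use mu_law[OF \<open>scale_function \<psi> W\<close> s] False in auto)
  qed
  obtain W\<^sub>s where W\<^sub>s: "W\<^sub>s \<in> borel_measurable S" "\<And>\<omega>. 0 < W\<^sub>s \<omega>" "distr S borel W\<^sub>s = S"
      "\<And>l. (LINT \<omega>|S. exp (- l * W\<^sub>s \<omega>)) = (LINT r|S. exp (- l * r))"
    by (rule positive_version_of_identity[OF S(2,3)]) (rule that)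
  have laplace: "(LINT \<omega>|S. exp (- l * W\<^sub>s \<omega>)) = ?L l" if "0 < l" for l
    using W\<^sub>s(4) S(4)[OF that] by simp
  show "\<exists>(S :: real measure) (W\<^sub>s :: real \<Rightarrow> real).
    prob_space S \<and> W\<^sub>s \<in> borel_measurable S \<and> (\<forall>\<omega>\<in>space S. 0 < W\<^sub>s \<omega>) \<and>
    (\<forall>l>0. \<forall>x>0.
      ((\<lambda>t. expectation_given_event (P x) (\<lambda>\<omega>. exp (- l * Z t \<omega>))
              {\<omega> \<in> space M. ennreal t \<le> extinction_time Z \<omega> \<and> extinction_time Z \<omega> < ennreal (t + s)})
        \<longlongrightarrow> (LINT \<omega>|S. exp (- l * W\<^sub>s \<omega>))) at_top \<and>
      (LINT \<omega>|S. exp (- l * W\<^sub>s \<omega>)) = ?L l) \<and>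
    (\<alpha> = 0 \<longrightarrow> distr S borel W\<^sub>s = mu \<psi> W s) \<and>
    (\<alpha> > 0 \<longrightarrow> distr S borel W\<^sub>s = ?Y)"
  proof (intro exI conjI ballI allI impI)
    fix l x :: real assume "0 < l" "0 < x"
    then show "((\<lambda>t. expectation_given_event (P x) (\<lambda>\<omega>. exp (- l * Z t \<omega>))
              {\<omega> \<in> space M. ennreal t \<le> extinction_time Z \<omega> \<and> extinction_time Z \<omega> < ennreal (t + s)})
        \<longlongrightarrow> (LINT \<omega>|S. exp (- l * W\<^sub>s \<omega>))) at_top"
      unfolding laplace[OF \<open>0 < l\<close>] by (intro conditional_laplace_limit alpha_nonneg s)
  qed (use S W\<^sub>s law laplace in auto)
qed

end
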